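(* Let $f:\mathbb{R}^d\to\mathbb{R}$ be SPB with parameters $\mathrm{R}_1,\mathrm{R}_2,m$, with $\inf_{\mathbb{R}^d}f>-\infty$. Fix $\sigma>0$, $x^0\in\mathbb{R}^d$ and $\{\tau_k\}\subset(0,1]$, and generate $\{x^k\}$ by: for $k=0,1,2,\dots$, draw $u^k\sim\mathcal{N}(0,I)$ independently of the past, set $v^k=\sigma^{-1}[f(x^k+\sigma u^k)-f(x^k)]u^k$ and \[x^{k+1}=x^k-\tau_k\frac{v^k}{\|x^k\|^{2m}+1}.\] Let $\mathbb{E}$ denote expectation over all the $u^k$, $f_\sigma(x)=\mathbb{E}_{u\sim\mathcal{N}(0,I)}[f(x+\sigma u)]$, $\mathcal{A}=2^{2m-2}\mathrm{R}_1\sigma^{m-1}(m+1+d)^{(m+1)/2}+\sigma^{-1}\mathrm{R}_2\sqrt d$, $\mathcal{B}=2^{2m-2}\sigma^{-1}\mathrm{R}_1\sqrt d$, $\mathcal{C}=2^{m-1}\sigma^{-1}\mathrm{R}_1\sqrt d$. Then for all $k\ge0$, \[\mathbb{E}[f_\sigma(x^{k+1})]\le\mathbb{E}[f_\sigma(x^k)]+\frac{\mathcal{H}_{(2)}\tau_k^2(\mathcal{A}+\mathcal{B})}{2}+\frac{\mathcal{C}}{m+2}\mathcal{H}_{(m+2)}\tau_k^{m+2},\] and for any integer $T>0$, \[\min_{0\le k\le T}\widetilde w_k^2\le\frac{\mathcal{M}(x^0)\sigma+f(x^0)-\inf f+0.5\mathcal{H}_{(2)}(\mathcal{A}+\mathcal{B})\sum_{k=0}^T\tau_k^2+\frac{\mathcal{H}_{(m+2)}\mathcal{C}}{m+2}\sum_{k=0}^T\tau_k^{m+2}}{\sum_{k=0}^T\tau_k},\]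 where $\widetilde w_k^2=\mathbb{E}\big[\|\nabla f_\sigma(x^k)\|^2/(\|x^k\|^m+1)^2\big]$, $\mathcal{M}(x)=(2^{m-1}\mathrm{R}_1\|x\|^m+\mathrm{R}_2)\sqrt d+2^{m-1}\mathrm{R}_1\sigma^m(m+1+d)^{(m+1)/2}$, and for an integer $p\ge1$, $\mathcal{H}_{(p)}=3^{p-1}\max\big\{2^{(m-1)p}\mathrm{R}_1^p(2p+d)^p,\ \mathrm{R}_2^p(2p+d)^p+2^{(m-1)p}\mathrm{R}_1^p\sigma^{mp}[(m+2)p+d]^{(m+2)p/2}\big\}$.
   Context: $\mathcal{N}(0,I)$ is the $d$-dimensional standard Gaussian distribution; $\|\cdot\|$ the Euclidean norm. $f$ is SPB with parameters $\mathrm{R}_1\ge0$, $\mathrm{R}_2>0$, integer $m\ge0$ (with $\mathrm{R}_1=0$ iff $m=0$) if $f$ is locally Lipschitz and $\sup_{\zeta\in\partial_Cf(x)}\|\zeta\|\le\mathrm{R}_1\|x\|^m+\mathrm{R}_2$ for all $x$, where $\partial_C f$ is the Clarke subdifferential (convention $0^0=1$). For such $f$, $f_\sigma$ is continuously differentiable. *)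

theory Defs
  imports "HOL-Probability.Probability"
begin

definition locally_lipschitz :: "('a::euclidean_space \<Rightarrow> real) \<Rightarrow> bool" where
  "locally_lipschitz f \<longleftrightarrow>
     (\<forall>x. \<exists>e>0. \<exists>L. \<forall>y\<in>ball x e. \<forall>z\<in>ball x e. \<bar>f y - f z\<bar> \<le> L * dist y z)"

definition clarke_dir_deriv :: "('a::euclidean_space \<Rightarrow> real) \<Rightarrow> 'a \<Rightarrow> 'a \<Rightarrow> ereal" where
  "clarke_dir_deriv f x v =
     Limsup (at (x, 0) within (UNIV \<times> {0<..}))
       (\<lambda>(y, t). ereal ((f (y + t *\<^sub>R v) - f y) / t))"

definition clarke_subdiff :: "('a::euclidean_space \<Rightarrow> real) \<Rightarrow> 'a \<Rightarrow> 'a set" where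
  "clarke_subdiff f x = {\<zeta>. \<forall>v. ereal (\<zeta> \<bullet> v) \<le> clarke_dir_deriv f x v}"

definition SPB :: "('a::euclidean_space \<Rightarrow> real) \<Rightarrow> real \<Rightarrow> real \<Rightarrow> nat \<Rightarrow> bool" where
  "SPB f R1 R2 m \<longleftrightarrow> R1 \<ge> 0 \<and> R2 > 0 \<and> (R1 = 0 \<longleftrightarrow> m = 0) \<and> locally_lipschitz f \<and>
     (\<forall>x. \<forall>\<zeta>\<in>clarke_subdiff f x. norm \<zeta> \<le> R1 * norm x ^ m + R2)"

definition std_gaussian :: "'a::euclidean_space measure" where
  "std_gaussian = density lborel
     (\<lambda>x. ennreal ((2 * pi) powr (- real DIM('a) / 2) * exp (- (norm x)\<^sup>2 / 2)))"

definition gauss_smooth :: "('a::euclidean_space \<Rightarrow> real) \<Rightarrow> real \<Rightarrow> 'a \<Rightarrow> real" where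
  "gauss_smooth f \<sigma> x = (\<integral>u. f (x + \<sigma> *\<^sub>R u) \<partial>std_gaussian)"

definition grad :: "('a::euclidean_space \<Rightarrow> real) \<Rightarrow> 'a \<Rightarrow> 'a" where
  "grad g x = (THE D. GDERIV g x :> D)"

primrec zo_iter :: "('a::euclidean_space \<Rightarrow> real) \<Rightarrow> real \<Rightarrow> (nat \<Rightarrow> real) \<Rightarrow> nat \<Rightarrow> 'a
    \<Rightarrow> (nat \<Rightarrow> 'w \<Rightarrow> 'a) \<Rightarrow> nat \<Rightarrow> 'w \<Rightarrow> 'a" where
  "zo_iter f \<sigma> \<tau> m x0 u 0 \<omega> = x0"
| "zo_iter f \<sigma> \<tau> m x0 u (Suc k) \<omega> =
     (let x = zo_iter f \<sigma> \<tau> m x0 u k \<omega>;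
          v = ((f (x + \<sigma> *\<^sub>R u k \<omega>) - f x) / \<sigma>) *\<^sub>R u k \<omega>
      in x - (\<tau> k / (norm x ^ (2 * m) + 1)) *\<^sub>R v)"

definition H_const :: "real \<Rightarrow> real \<Rightarrow> nat \<Rightarrow> real \<Rightarrow> nat \<Rightarrow> nat \<Rightarrow> real" where
  "H_const R1 R2 m \<sigma> d p = 3 ^ (p - 1) *
     max (2 powr ((real m - 1) * p) * R1 ^ p * (2 * real p + d) ^ p)
         (R2 ^ p * (2 * real p + d) ^ p
          + 2 powr ((real m - 1) * p) * R1 ^ p * \<sigma> ^ (m * p)
            * (real ((m + 2) * p) + d) powr (real ((m + 2) * p) / 2))"

end

theory Submission
  imports Defs
begin

text \<open>
  Lebourg's mean value inequality turns the bound on Clarke subgradients into a Lipschitz bound with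
  constant \<open>R\<^sub>1 N\<^sup>m + R\<^sub>2\<close> on the ball of radius \<open>N\<close>. Moving translations from \<open>f\<close> to the Gaussian density
  shows that \<open>f\<^sub>\<sigma>\<close> is differentiable with gradient \<open>E[v]\<close>, and the Lipschitz bound gives
  \<open>\<parallel>\<nabla>f\<^sub>\<sigma> (x + h) - \<nabla>f\<^sub>\<sigma> x\<parallel> \<le> (A + B \<parallel>x\<parallel>\<^sup>m + C \<parallel>h\<parallel>\<^sup>m) \<parallel>h\<parallel>\<close>. Integrating along a segment yields a descent inequality
  whose error terms are controlled, after the normalisation by \<open>\<parallel>x\<parallel>\<^bsup>2m\<^esup> + 1\<close>, by the moments of \<open>v\<close>.
  Averaging over the fresh Gaussian sample, which is independent of the current iterate, and telescoping
  give both claims.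
\<close>

section \<open>Clarke subgradients and Lipschitz bounds\<close>

text \<open>The local Lipschitz modulus of the gradient of f_\<sigma> grows like
  \<open>norm x ^ m\<close>, and the p-th moment of the search direction like
  \<open>norm x ^ (m * p)\<close>, while no bound on the iterates is available. The normalisation
  absorbs both: with s = \<open>norm x ^ m\<close> and r = t / (s^2 + 1), the second-order error is
  a multiple of r^2 (A + B s) (s^2 + 1) <= t^2 (A + B), and the error of order m + 2 is a multiple
  of r^(m+2) (s^(m+2) + 1) <= t^(m+2), both uniformly in x. The price is the weight 1 / (s^2 + 1) on
  the squared gradient, which is weakened to 1 / (s + 1)^2. Origin of the constants: splitting the
  m-th power of a two-term sum costs 2^(m-1); this happens once for C and M(x0), twice for the R1
  terms of A and B. The p-th power of a three-term sum costs 3^(p-1). The first Gaussian moment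
  yields sqrt d, the moment of order m + 1 yields (m+1+d)^((m+1)/2). The summand M(x0) \<sigma>
  bounds f_\<sigma>(x0) - f(x0), and inf f is a lower bound of f_\<sigma> as well.\<close>

lemma sublinear_support:
  fixes p :: "'a::euclidean_space \<Rightarrow> real"
  assumes add: "\<And>v w. p (v + w) \<le> p v + p w"
    and scale: "\<And>c v. c > 0 \<Longrightarrow> p (c *\<^sub>R v) = c * p v"
  obtains \<zeta> where "\<And>w. \<zeta> \<bullet> w \<le> p w" "\<zeta> \<bullet> v = p v"
proof -
  \<comment> \<open>Hahn-Banach with contact at \<open>v\<close>: the strict epigraph of
    \<open>p\<close> is convex and misses the point \<open>(v, p v)\<close> on the graph; the slope
    of a separating hyperplane is the functional sought.\<close>
  define S where "S = {(w, t). p w < t}"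
  have conv: "convex S"
    unfolding convex_def
  proof safe
    fix w1 w2 :: 'a and t1 t2 a b :: real
    assume S: "(w1, t1) \<in> S" "(w2, t2) \<in> S" and ab: "0 \<le> a" "0 \<le> b" "a + b = 1"
    have "p (a *\<^sub>R w1 + b *\<^sub>R w2) < a * t1 + b * t2"
    proof (cases "a = 0 \<or> b = 0")
      case True
      then show ?thesis using S ab by (auto simp: S_def)
    next
      case False
      then have pos: "0 < a" "0 < b" using ab by auto
      have "p (a *\<^sub>R w1 + b *\<^sub>R w2) \<le> a * p w1 + b * p w2"
        using add[of "a *\<^sub>R w1" "b *\<^sub>R w2"] scale pos by simp
      also have "\<dots> < a * t1 + b * t2"
        using S pos by (intro add_strict_mono) (auto simp: S_def)
      finally show ?thesis .
    qed
    then show "a *\<^sub>R (w1, t1) + b *\<^sub>R (w2, t2) \<in> S" by (simp add: S_def)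
  qed
  have p0: "p 0 = 0" using scale[of 2 0] by simp
  have "(0, 1) \<in> S" by (simp add: S_def p0)
  then have "S \<noteq> {}" by blast
  moreover have "S \<inter> {(v, p v)} = {}" by (auto simp: S_def)
  ultimately obtain z c where z: "z \<noteq> 0" "\<forall>q\<in>S. z \<bullet> q \<le> c" "\<forall>q\<in>{(v, p v)}. c \<le> z \<bullet> q"
    using separating_hyperplane_sets[OF conv convex_singleton, of "(v, p v)"] by blast
  obtain a b where zab: "z = (a, b)" by (cases z)
  have sep: "a \<bullet> w + b * t \<le> a \<bullet> v + b * p v" if "p w < t" for w t
    using z(2,3) that unfolding zab S_def by fastforce
  have "b \<le> 0"
    using sep[of v "p v + 1"] by (simp add: algebra_simps)
  \<comment> \<open>A vertical hyperplane would bound the linear functional \<open>a\<close> on the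
    whole space; testing it at \<open>v + a\<close> forces \<open>a = 0\<close>.\<close>
  moreover have "b \<noteq> 0"
  proof
    assume b: "b = 0"
    then have "a \<bullet> (v + a) \<le> a \<bullet> v"
      using sep[of "v + a" "p (v + a) + 1"] by simp
    then have "a \<bullet> a \<le> 0" by (simp add: inner_add_right)
    then have "a = 0" by (metis inner_gt_zero_iff not_le)
    with b z(1) zab show False by (simp add: zero_prod_def)
  qed
  ultimately have b: "b < 0" by simp
  define \<zeta> where "\<zeta> = (- 1 / b) *\<^sub>R a"
  have sup: "\<zeta> \<bullet> w - p w \<le> \<zeta> \<bullet> v - p v" for w
  proof -
    have "\<zeta> \<bullet> w - (\<zeta> \<bullet> v - p v) \<le> t" if "p w < t" for t
      using sep[OF that] b by (simp add: \<zeta>_def field_simps)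
    then have "\<zeta> \<bullet> w - (\<zeta> \<bullet> v - p v) \<le> p w" by (rule dense_ge)
    then show ?thesis by simp
  qed
  have le: "\<zeta> \<bullet> w \<le> p w" for w
  proof (rule ccontr)
    assume "\<not> \<zeta> \<bullet> w \<le> p w"
    then have pos: "\<zeta> \<bullet> w - p w > 0" by simp
    \<comment> \<open>If \<open>\<zeta> \<bullet> w - p w\<close> were positive, homogeneity would
      make it arbitrarily large along the ray of \<open>w\<close>, against the upper bound
      \<open>sup\<close>. This \<open>K\<close> just exceeds that bound.\<close>
    define K where "K = \<bar>\<zeta> \<bullet> v - p v\<bar> / (\<zeta> \<bullet> w - p w) + 1"
    have K: "K > 0" unfolding K_def using pos by (intro add_nonneg_pos) auto
    have "K * (\<zeta> \<bullet> w - p w) \<le> \<zeta> \<bullet> v - p v"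
      using sup[of "K *\<^sub>R w"] scale[OF K] by (simp add: algebra_simps)
    moreover have "K * (\<zeta> \<bullet> w - p w) = \<bar>\<zeta> \<bullet> v - p v\<bar> + (\<zeta> \<bullet> w - p w)"
      using pos unfolding K_def by (simp add: field_simps)
    ultimately show False using pos by linarith
  qed
  moreover have "\<zeta> \<bullet> v = p v"
    using le[of v] sup[of 0] p0 by simp
  ultimately show ?thesis using that by blast
qed

text \<open>With \<open>clarke_dir_deriv_leI\<close> this trades the extended-real limsup for
  increment estimates, uniform in the base point and the step length. A strict bound on the limsup
  is needed to extract such an estimate, a weak one is what comes back.\<close>

lemma clarke_dir_deriv_lessD:
  assumes "clarke_dir_deriv f x v < ereal c"
  obtains \<delta> where "\<delta> > 0"
    "\<And>y t. dist y x < \<delta> \<Longrightarrow> 0 < t \<Longrightarrow> t < \<delta> \<Longrightarrow> f (y + t *\<^sub>R v) - f y < c * t"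
proof -
  have "\<forall>\<^sub>F z in at (x, 0) within (UNIV \<times> {0<..}).
      (case z of (y, t) \<Rightarrow> ereal ((f (y + t *\<^sub>R v) - f y) / t)) < ereal c"
    using assms unfolding clarke_dir_deriv_def by (rule Limsup_lessD)
  then obtain e where e: "e > 0" "\<And>y t. t > 0 \<Longrightarrow> dist (y, t) (x, 0) < e \<Longrightarrow>
      (f (y + t *\<^sub>R v) - f y) / t < c"
    unfolding eventually_at by (auto split: prod.splits)
  show ?thesis
  proof
    show "e / 2 > 0" using e by simp
    fix y t assume yt: "dist y x < e / 2" "0 < t" "t < e / 2"
    have "dist (y, t) (x, 0) < e"
      using sqrt_sum_squares_le_sum[of "dist y x" t] yt by (simp add: dist_Pair_Pair)
    then have "(f (y + t *\<^sub>R v) - f y) / t < c"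
      using e yt by blast
    then show "f (y + t *\<^sub>R v) - f y < c * t"
      using yt by (simp add: field_simps)
  qed
qed

lemma clarke_dir_deriv_leI:
  assumes "\<delta> > 0"
    "\<And>y t. dist y x < \<delta> \<Longrightarrow> 0 < t \<Longrightarrow> t < \<delta> \<Longrightarrow> f (y + t *\<^sub>R v) - f y \<le> c * t"
  shows "clarke_dir_deriv f x v \<le> ereal c"
  unfolding clarke_dir_deriv_def
proof (rule Limsup_bounded)
  have "ereal ((f (y + t *\<^sub>R v) - f y) / t) \<le> ereal c"
    if "t > 0" "dist (y, t) (x, 0) < \<delta>" for y t
  proof -
    have "dist y x < \<delta>" "t < \<delta>"
      using that dist_fst_le[of "(y, t)" "(x, 0)"] dist_snd_le[of "(y, t)" "(x, 0)"]
      by (auto simp: dist_real_def)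
    then show ?thesis
      using assms(2)[of y t] that by (simp add: field_simps)
  qed
  then show "\<forall>\<^sub>F z in at (x, 0) within (UNIV \<times> {0<..}).
      (case z of (y, t) \<Rightarrow> ereal ((f (y + t *\<^sub>R v) - f y) / t)) \<le> ereal c"
    unfolding eventually_at using assms(1) by (auto intro!: exI[of _ \<delta>])
qed

text \<open>Near \<open>x\<close> all difference quotients lie between \<open>- L * norm v\<close>
  and \<open>L * norm v\<close>. A limsup below the lower value would push the quotients based at
  \<open>x\<close> itself below it.\<close>

lemma clarke_dir_deriv_finite:
  assumes "locally_lipschitz f"
  shows "\<bar>clarke_dir_deriv f x v\<bar> \<noteq> \<infinity>"
proof -
  obtain e L where e: "e > 0"
    and L: "\<And>y z. y \<in> ball x e \<Longrightarrow> z \<in> ball x e \<Longrightarrow> \<bar>f y - f z\<bar> \<le> L * dist y z"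
    using assms unfolding locally_lipschitz_def by meson
  define \<delta> where "\<delta> = e / (2 * (norm v + 1))"
  have nv: "norm v + 1 > 0" using norm_ge_zero[of v] by linarith
  have \<delta>: "\<delta> > 0" "\<delta> \<le> e / 2" "\<delta> * norm v \<le> e / 2"
    using e nv unfolding \<delta>_def by (auto simp: field_simps)
  have bd: "\<bar>f (y + t *\<^sub>R v) - f y\<bar> \<le> (L * norm v) * t"
    if "dist y x < \<delta>" "0 < t" "t < \<delta>" for y t
  proof -
    have "norm (t *\<^sub>R v) \<le> e / 2"
      using that \<delta> mult_right_mono[of t \<delta> "norm v"] by simp
    moreover have "dist (y + t *\<^sub>R v) x \<le> dist y x + norm (t *\<^sub>R v)"
      using norm_triangle_ineq[of "y - x" "t *\<^sub>R v"] by (simp add: dist_norm algebra_simps)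
    ultimately have "y \<in> ball x e" "y + t *\<^sub>R v \<in> ball x e"
      using that \<delta> e by (auto simp: dist_commute)
    from L[OF this(2) this(1)] show ?thesis
      using that by (simp add: dist_norm ac_simps)
  qed
  have "clarke_dir_deriv f x v \<le> ereal (L * norm v)"
    using bd by (intro clarke_dir_deriv_leI[OF \<delta>(1)]) (meson abs_le_D1)
  moreover have "\<not> clarke_dir_deriv f x v < ereal (- (L * norm v))"
  proof
    assume "clarke_dir_deriv f x v < ereal (- (L * norm v))"
    then obtain \<eta> where \<eta>: "\<eta> > 0"
      "\<And>y t. dist y x < \<eta> \<Longrightarrow> 0 < t \<Longrightarrow> t < \<eta> \<Longrightarrow> f (y + t *\<^sub>R v) - f y < - (L * norm v) * t"
      by (rule clarke_dir_deriv_lessD) blast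
    obtain t where t: "0 < t" "t < \<eta>" "t < \<delta>"
      using \<eta>(1) \<delta>(1) by (meson field_lbound_gt_zero)
    have "f (x + t *\<^sub>R v) - f x < - (L * norm v) * t" by (rule \<eta>(2)) (use t \<eta> in auto)
    moreover have "\<bar>f (x + t *\<^sub>R v) - f x\<bar> \<le> (L * norm v) * t" by (rule bd) (use t \<delta> in auto)
    ultimately show False by (simp add: abs_le_iff)
  qed
  ultimately show ?thesis
    by (cases "clarke_dir_deriv f x v") auto
qed

text \<open>The directional derivative is the support function of the Clarke subdifferential: it is
  finite and sublinear in the direction, so \<open>sublinear_support\<close> provides a subgradient
  that touches it at \<open>v\<close>.\<close>

lemma clarke_dir_deriv_attained:
  assumes "locally_lipschitz f"
  obtains \<zeta> where "\<zeta> \<in> clarke_subdiff f x" "clarke_dir_deriv f x v = ereal (\<zeta> \<bullet> v)"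
proof -
  define p where "p w = real_of_ereal (clarke_dir_deriv f x w)" for w
  have p: "clarke_dir_deriv f x w = ereal (p w)" for w
    using clarke_dir_deriv_finite[OF assms, of x w] by (simp add: p_def ereal_real)
  have p_le: "p w \<le> c" if "\<delta> > 0"
    "\<And>y t. dist y x < \<delta> \<Longrightarrow> 0 < t \<Longrightarrow> t < \<delta> \<Longrightarrow> f (y + t *\<^sub>R w) - f y \<le> c * t" for w c \<delta>
    using clarke_dir_deriv_leI[of \<delta> x f w c] that p by simp
  \<comment> \<open>One inequality suffices: the reverse one is the same statement for
    \<open>1 / a\<close> and \<open>a *\<^sub>R w\<close>.\<close>
  have scale_le: "p (a *\<^sub>R w) \<le> a * p w" if a: "a > 0" for a w
  proof (rule field_le_epsilon)
    fix e :: real assume e: "e > 0"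
    then have "clarke_dir_deriv f x w < ereal (p w + e / a)" using a by (simp add: p)
    then obtain \<delta> where \<delta>: "\<delta> > 0"
      "\<And>y t. dist y x < \<delta> \<Longrightarrow> 0 < t \<Longrightarrow> t < \<delta> \<Longrightarrow> f (y + t *\<^sub>R w) - f y < (p w + e / a) * t"
      by (rule clarke_dir_deriv_lessD) blast
    show "p (a *\<^sub>R w) \<le> a * p w + e"
    proof (rule p_le[of "min \<delta> (\<delta> / a)"])
      show "min \<delta> (\<delta> / a) > 0" using \<delta> a by simp
      fix y t assume yt: "dist y x < min \<delta> (\<delta> / a)" "0 < t" "t < min \<delta> (\<delta> / a)"
      then have "t * a < \<delta>" using a by (simp add: field_simps)
      then have "f (y + (t * a) *\<^sub>R w) - f y < (p w + e / a) * (t * a)"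
        using yt a by (intro \<delta>(2)) auto
      moreover have "(p w + e / a) * (t * a) = (a * p w + e) * t" using a by (simp add: field_simps)
      ultimately show "f (y + t *\<^sub>R a *\<^sub>R w) - f y \<le> (a * p w + e) * t" by simp
    qed
  qed
  have scale: "p (a *\<^sub>R w) = a * p w" if a: "a > 0" for a w
    using scale_le[OF a, of w] scale_le[of "1 / a" "a *\<^sub>R w"] a by (simp add: field_simps)
  \<comment> \<open>The increment along \<open>v + w\<close> is split at
    \<open>y + t *\<^sub>R w\<close>. This is where the moving base point in Clarke's definition
    matters: the increment along \<open>v\<close> starts at a point other than \<open>y\<close>, and
    \<open>\<eta>\<close> keeps that point within \<open>\<delta>\<close> of
    \<open>x\<close>.\<close>
  have add: "p (v + w) \<le> p v + p w" for v w
  proof (rule field_le_epsilon)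
    fix e :: real assume e: "e > 0"
    then have "clarke_dir_deriv f x v < ereal (p v + e / 2)"
      "clarke_dir_deriv f x w < ereal (p w + e / 2)" by (simp_all add: p)
    then obtain \<delta> \<delta>' where \<delta>: "\<delta> > 0"
      "\<And>y t. dist y x < \<delta> \<Longrightarrow> 0 < t \<Longrightarrow> t < \<delta> \<Longrightarrow> f (y + t *\<^sub>R v) - f y < (p v + e / 2) * t"
      and \<delta>': "\<delta>' > 0"
      "\<And>y t. dist y x < \<delta>' \<Longrightarrow> 0 < t \<Longrightarrow> t < \<delta>' \<Longrightarrow> f (y + t *\<^sub>R w) - f y < (p w + e / 2) * t"
      by (metis clarke_dir_deriv_lessD)
    define \<eta> where "\<eta> = min \<delta>' (\<delta> / (norm w + 1))"
    have nw: "norm w + 1 > 0" using norm_ge_zero[of w] by linarith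
    have \<eta>: "\<eta> > 0" using \<delta> \<delta>' nw by (simp add: \<eta>_def)
    have \<eta>_le: "\<eta> * norm w + \<eta> \<le> \<delta>"
    proof -
      have "\<eta> \<le> \<delta> / (norm w + 1)" by (simp add: \<eta>_def)
      then show ?thesis using nw by (simp add: field_simps)
    qed
    have \<eta>0: "0 \<le> \<eta> * norm w" using \<eta> by simp
    show "p (v + w) \<le> p v + p w + e"
    proof (rule p_le[OF \<eta>])
      fix y t assume yt: "dist y x < \<eta>" "0 < t" "t < \<eta>"
      have "norm (t *\<^sub>R w) \<le> \<eta> * norm w"
        using yt mult_right_mono[of t \<eta> "norm w"] by simp
      moreover have "dist (y + t *\<^sub>R w) x \<le> dist y x + norm (t *\<^sub>R w)"
        using norm_triangle_ineq[of "y - x" "t *\<^sub>R w"] by (simp add: dist_norm algebra_simps)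
      ultimately have d: "dist (y + t *\<^sub>R w) x < \<delta>" using yt \<eta>_le by linarith
      have "f (y + t *\<^sub>R w + t *\<^sub>R v) - f (y + t *\<^sub>R w) < (p v + e / 2) * t"
        by (rule \<delta>(2)[OF d]) (use yt \<eta>_le \<eta>0 in linarith)+
      moreover have "f (y + t *\<^sub>R w) - f y < (p w + e / 2) * t"
        by (rule \<delta>'(2)) (use yt in \<open>auto simp: \<eta>_def\<close>)
      ultimately show "f (y + t *\<^sub>R (v + w)) - f y \<le> (p v + p w + e) * t"
        by (simp add: algebra_simps)
    qed
  qed
  obtain \<zeta> where "\<And>w. \<zeta> \<bullet> w \<le> p w" "\<zeta> \<bullet> v = p v"
    using sublinear_support[of p v] add scale by blast
  then show ?thesis
    using that[of \<zeta>] by (simp add: clarke_subdiff_def p)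
qed

text \<open>Lebourg's theorem in inequality form, by bisection of [0,1]: the claim is additive over
  adjacent intervals, and it holds on short intervals around each \<open>s\<close> because the
  Clarke derivative in direction \<open>h\<close> is attained by a subgradient of norm at most
  \<open>L\<close>.\<close>

lemma lipschitz_of_clarke_subdiff_bound:
  fixes f :: "'a::euclidean_space \<Rightarrow> real"
  assumes lip: "locally_lipschitz f" and S: "convex S" "a \<in> S" "b \<in> S"
    and bound: "\<And>x \<zeta>. x \<in> S \<Longrightarrow> \<zeta> \<in> clarke_subdiff f x \<Longrightarrow> norm \<zeta> \<le> L"
  shows "f b - f a \<le> L * norm (b - a)"
proof (rule field_le_epsilon)
  fix e :: real assume e: "e > 0"
  define h where "h = b - a"
  \<comment> \<open>The slack \<open>e\<close> makes the bound on the Clarke derivative strict, as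
    \<open>clarke_dir_deriv_lessD\<close> requires.\<close>
  define c where "c = L * norm h + e"
  define g where "g s = f (a + s *\<^sub>R h)" for s
  have "(0::real) \<le> 1" by simp
  then have "g 1 - g 0 \<le> c * (1 - 0)"
  proof (induction rule: Bolzano)
    case (trans r s t)
    then show ?case by (simp add: algebra_simps)
  next
    case (local s)
    have "(1 - s) *\<^sub>R a + s *\<^sub>R b \<in> S"
      using S local by (intro convexD) auto
    then have in_S: "a + s *\<^sub>R h \<in> S" by (simp add: h_def algebra_simps)
    obtain \<zeta> where \<zeta>: "\<zeta> \<in> clarke_subdiff f (a + s *\<^sub>R h)"
      "clarke_dir_deriv f (a + s *\<^sub>R h) h = ereal (\<zeta> \<bullet> h)"
      using clarke_dir_deriv_attained[OF lip] by blast
    have "\<zeta> \<bullet> h \<le> norm \<zeta> * norm h" by (rule norm_cauchy_schwarz)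
    also have "\<dots> \<le> L * norm h" by (intro mult_right_mono bound[OF in_S \<zeta>(1)]) simp
    also have "\<dots> < c" using e by (simp add: c_def)
    finally have "clarke_dir_deriv f (a + s *\<^sub>R h) h < ereal c" by (simp add: \<zeta>)
    then obtain \<delta> where \<delta>: "\<delta> > 0" "\<And>y t. dist y (a + s *\<^sub>R h) < \<delta> \<Longrightarrow> 0 < t \<Longrightarrow> t < \<delta> \<Longrightarrow>
        f (y + t *\<^sub>R h) - f y < c * t"
      by (rule clarke_dir_deriv_lessD) blast
    define d where "d = \<delta> / (norm h + 1)"
    have nh: "norm h + 1 > 0" using norm_ge_zero[of h] by linarith
    have d: "d > 0" using \<delta> nh by (simp add: d_def)
    have "d * (norm h + 1) = \<delta>" using nh by (simp add: d_def)
    then have d_eq: "d * norm h + d = \<delta>" by (simp add: algebra_simps)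
    have dh: "0 \<le> d * norm h" using d by simp
    have "g r' - g r \<le> c * (r' - r)" if r: "r \<le> s" "s \<le> r'" "r' - r < d" for r r'
    proof (cases "r = r'")
      case False
      have "dist (a + r *\<^sub>R h) (a + s *\<^sub>R h) = (s - r) * norm h"
        using r by (simp add: dist_norm norm_minus_commute flip: scaleR_diff_left)
      also have "\<dots> \<le> d * norm h" using r by (intro mult_right_mono) auto
      finally have "dist (a + r *\<^sub>R h) (a + s *\<^sub>R h) < \<delta>" using d_eq d by linarith
      then have "f (a + r *\<^sub>R h + (r' - r) *\<^sub>R h) - f (a + r *\<^sub>R h) < c * (r' - r)"
        by (rule \<delta>(2)) (use False r d_eq dh in linarith)+
      then show ?thesis by (simp add: g_def algebra_simps)
    qed simp
    then show ?case using d by blast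
  qed
  then show "f b - f a \<le> L * norm (b - a) + e" by (simp add: g_def c_def h_def)
qed

lemma SPB_lipschitz_on_cball:
  assumes "SPB f R1 R2 m" "norm x \<le> N" "norm y \<le> N"
  shows "\<bar>f x - f y\<bar> \<le> (R1 * N ^ m + R2) * norm (x - y)"
proof -
  have "norm \<zeta> \<le> R1 * N ^ m + R2" if "z \<in> cball 0 N" "\<zeta> \<in> clarke_subdiff f z" for z \<zeta>
  proof -
    have "norm \<zeta> \<le> R1 * norm z ^ m + R2" using assms(1) that by (auto simp: SPB_def)
    also have "\<dots> \<le> R1 * N ^ m + R2"
      using assms(1) that by (intro add_right_mono mult_left_mono power_mono) (auto simp: SPB_def)
    finally show ?thesis .
  qed
  then have "f b - f a \<le> (R1 * N ^ m + R2) * norm (b - a)"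
    if "norm a \<le> N" "norm b \<le> N" for a b
    using assms(1) that
    by (intro lipschitz_of_clarke_subdiff_bound[where S="cball 0 N"]) (auto simp: SPB_def)
  from this[of x y] this[of y x] assms show ?thesis by (simp add: norm_minus_commute abs_le_iff)
qed

section \<open>Moments of the standard Gaussian\<close>

lemma sets_std_gaussian [simp, measurable_cong]: "sets std_gaussian = sets borel"
  by (simp add: std_gaussian_def)

lemma space_std_gaussian [simp]: "space std_gaussian = UNIV"
  by (simp add: std_gaussian_def)

text \<open>The one explicit Gaussian integral behind all moment bounds: \<open>b = 0\<close> gives
  total mass 1, small \<open>b\<close> the second moment, and \<open>b = n / (n + d)\<close> the
  moment of order \<open>n\<close>.\<close>

lemma nn_integral_std_gaussian_exp_square:
  assumes b: "b < 1"
  shows "(\<integral>\<^sup>+u. ennreal (exp (b * (norm u)\<^sup>2 / 2)) \<partial>(std_gaussian :: 'a::euclidean_space measure))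
    = ennreal ((1 - b) powr (- real DIM('a) / 2))"
proof -
  define s where "s = 1 - b"
  have s: "s > 0" using b by (simp add: s_def)
  \<comment> \<open>The tilt changes the variance from 1 to 1 / (1 - b). The tilted density is a
    constant times a product of these one-dimensional normal densities, each of integral 1.\<close>
  define \<phi> where "\<phi> = normal_density 0 (1 / sqrt s)"
  have \<phi>: "\<phi> t = (2 * pi / s) powr (- 1 / 2) * exp (- s * t\<^sup>2 / 2)" for t
    using s by (simp add: \<phi>_def normal_density_def powr_minus powr_half_sqrt power_divide field_simps)
  have prod: "(\<Prod>i\<in>Basis. \<phi> (u \<bullet> i))
      = (2 * pi / s) powr (- real DIM('a) / 2) * exp (- s * (norm u)\<^sup>2 / 2)" for u :: 'a
  proof -
    have "(norm u)\<^sup>2 = (\<Sum>i\<in>Basis. (u \<bullet> i)\<^sup>2)"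
      unfolding power2_norm_eq_inner by (subst euclidean_inner) (simp add: power2_eq_square)
    moreover have "((2 * pi / s) powr (- 1 / 2)) ^ DIM('a) = (2 * pi / s) powr (- real DIM('a) / 2)"
      using s by (simp add: powr_powr flip: powr_realpow)
    ultimately show ?thesis
      by (simp add: \<phi> prod.distrib sum_distrib_left sum_divide_distrib flip: exp_sum)
  qed
  have "(\<integral>\<^sup>+u. ennreal (exp (b * (norm u)\<^sup>2 / 2)) \<partial>(std_gaussian :: 'a measure))
      = (\<integral>\<^sup>+u. ennreal ((2 * pi) powr (- real DIM('a) / 2) * exp (- (norm u)\<^sup>2 / 2))
            * ennreal (exp (b * (norm u)\<^sup>2 / 2)) \<partial>(lborel :: 'a measure))"
    unfolding std_gaussian_def by (rule nn_integral_density) auto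
  also have "\<dots> = (\<integral>\<^sup>+u. ennreal (s powr (- real DIM('a) / 2)) * ennreal (\<Prod>i\<in>Basis. \<phi> (u \<bullet> i)) \<partial>(lborel :: 'a measure))"
  proof (rule nn_integral_cong)
    fix u :: 'a
    define D where "D = - real DIM('a) / 2"
    have 1: "exp (- (norm u)\<^sup>2 / 2) * exp (b * (norm u)\<^sup>2 / 2) = exp (- s * (norm u)\<^sup>2 / 2)"
      unfolding exp_add[symmetric] by (simp add: s_def field_simps)
    have 2: "s powr D * (2 * pi / s) powr D = (2 * pi) powr D"
      unfolding powr_mult[symmetric] using s by simp
    have "((2 * pi) powr D * exp (- (norm u)\<^sup>2 / 2)) * exp (b * (norm u)\<^sup>2 / 2)
        = s powr D * ((2 * pi / s) powr D * exp (- s * (norm u)\<^sup>2 / 2))"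
      unfolding mult.assoc 1 unfolding 2[symmetric] by simp
    then show "ennreal ((2 * pi) powr (- real DIM('a) / 2) * exp (- (norm u)\<^sup>2 / 2))
            * ennreal (exp (b * (norm u)\<^sup>2 / 2))
        = ennreal (s powr (- real DIM('a) / 2)) * ennreal (\<Prod>i\<in>Basis. \<phi> (u \<bullet> i))"
      unfolding prod by (subst (1 2) ennreal_mult[symmetric]) (auto simp: D_def)
  qed
  also have "\<dots> = ennreal (s powr (- real DIM('a) / 2)) * (\<integral>\<^sup>+u. (\<Prod>i\<in>Basis. ennreal (\<phi> (u \<bullet> i))) \<partial>(lborel :: 'a measure))"
    by (subst nn_integral_cmult) (auto simp: prod_ennreal \<phi>_def)
  also have "(\<integral>\<^sup>+u. (\<Prod>i\<in>Basis. ennreal (\<phi> (u \<bullet> i))) \<partial>(lborel :: 'a measure))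
      = (\<Prod>i\<in>(Basis :: 'a set). \<integral>\<^sup>+t. ennreal (\<phi> t) \<partial>lborel)"
    by (rule nn_integral_lborel_prod) (auto simp: \<phi>_def)
  also have "(\<integral>\<^sup>+t. ennreal (\<phi> t) \<partial>lborel) = 1"
    using s by (subst nn_integral_eq_integral) (auto simp: \<phi>_def)
  finally show ?thesis by (simp add: s_def)
qed

lemma prob_space_std_gaussian: "prob_space (std_gaussian :: 'a::euclidean_space measure)"
  using nn_integral_std_gaussian_exp_square[of 0, where 'a='a]
  by (intro prob_spaceI) simp

interpretation std_gaussian: prob_space "std_gaussian :: 'a::euclidean_space measure"
  by (rule prob_space_std_gaussian)

lemma
  assumes b: "b < 1"
  shows integrable_std_gaussian_exp_square:
      "integrable (std_gaussian :: 'a::euclidean_space measure) (\<lambda>u. exp (b * (norm u)\<^sup>2 / 2))"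
    and integral_std_gaussian_exp_square:
      "(\<integral>u. exp (b * (norm u)\<^sup>2 / 2) \<partial>(std_gaussian :: 'a measure)) = (1 - b) powr (- real DIM('a) / 2)"
proof -
  have "has_bochner_integral (std_gaussian :: 'a measure) (\<lambda>u. exp (b * (norm u)\<^sup>2 / 2))
      ((1 - b) powr (- real DIM('a) / 2))"
    by (rule has_bochner_integral_nn_integral)
      (auto simp: nn_integral_std_gaussian_exp_square[OF b])
  then show "integrable (std_gaussian :: 'a measure) (\<lambda>u. exp (b * (norm u)\<^sup>2 / 2))"
    "(\<integral>u. exp (b * (norm u)\<^sup>2 / 2) \<partial>(std_gaussian :: 'a measure)) = (1 - b) powr (- real DIM('a) / 2)"
    by (auto simp: has_bochner_integral_iff)
qed

text \<open>Exponential growth is a convenient class of integrands: it contains the polynomials and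
  is stable under multiplication by \<open>norm u\<close> and by the exponential factors of
  translated Gaussians.\<close>

lemma integrable_std_gaussian_exp_growth:
  fixes g :: "'a::euclidean_space \<Rightarrow> 'b::{banach, second_countable_topology}"
  assumes "g \<in> borel_measurable borel" and bound: "\<And>u. norm (g u) \<le> K * exp (c * norm u)"
  shows "integrable std_gaussian g"
proof (rule Bochner_Integration.integrable_bound)
  show "integrable std_gaussian (\<lambda>u :: 'a. K * exp (c\<^sup>2) * exp (1 / 2 * (norm u)\<^sup>2 / 2))"
    by (intro integrable_mult_right integrable_std_gaussian_exp_square) simp
  show "g \<in> borel_measurable std_gaussian" using assms by (simp cong: measurable_cong_sets)
  show "AE u in std_gaussian. norm (g u) \<le> norm (K * exp (c\<^sup>2) * exp (1 / 2 * (norm u)\<^sup>2 / 2))"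
  proof (rule AE_I2)
    fix u :: 'a
    have "0 \<le> K * exp (c * norm u)" using bound[of u] norm_ge_zero order_trans by blast
    then have K: "K \<ge> 0" by (simp add: zero_le_mult_iff)
    \<comment> \<open>Completing the square leaves a quarter of the squared norm in the exponent,
      which is the integrable case \<open>b = 1 / 2\<close>.\<close>
    have "0 \<le> (norm u / 2 - c)\<^sup>2" by simp
    then have "c * norm u \<le> c\<^sup>2 + 1 / 2 * (norm u)\<^sup>2 / 2"
      by (simp add: power2_diff power_divide mult.commute)
    then have "K * exp (c * norm u) \<le> K * exp (c\<^sup>2 + 1 / 2 * (norm u)\<^sup>2 / 2)"
      using K by (intro mult_left_mono) auto
    then show "norm (g u) \<le> norm (K * exp (c\<^sup>2) * exp (1 / 2 * (norm u)\<^sup>2 / 2))"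
      using bound[of u] K by (simp add: exp_add abs_mult)
  qed
qed

lemma power_le_fact_exp:
  fixes t :: real
  assumes "t \<ge> 0"
  shows "t ^ n \<le> fact n * exp t"
proof -
  have "t ^ n /\<^sub>R fact n \<le> exp t"
    unfolding exp_def using assms summable_exp_generic[of t]
    by (intro sum_le_suminf[of _ "{n}", simplified]) auto
  then show ?thesis by (simp add: field_simps)
qed

lemma integrable_std_gaussian_norm_power:
  "integrable (std_gaussian :: 'a::euclidean_space measure) (\<lambda>u. norm u ^ n)"
  by (rule integrable_std_gaussian_exp_growth[where K="fact n" and c=1])
    (auto intro: power_le_fact_exp)

lemma integrable_std_gaussian_id: "integrable std_gaussian (\<lambda>u :: 'a::euclidean_space. u)"
  by (rule Bochner_Integration.integrable_bound[OF integrable_std_gaussian_norm_power[of 1]]) auto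

text \<open>Chernoff's method: \<open>t\<^sup>2 \<le> (n + d) exp (t\<^sup>2 / (n + d) - 1)\<close>, raised to the power \<open>n / 2\<close>, reduces
  the moment to an exponential one.\<close>

lemma std_gaussian_norm_moment_le:
  "(\<integral>u. norm u ^ n \<partial>(std_gaussian :: 'a::euclidean_space measure))
    \<le> (real n + real DIM('a)) powr (real n / 2)"
proof -
  define d where "d = real DIM('a)"
  define q where "q = real n"
  have d: "d > 0" and q: "q \<ge> 0" by (simp_all add: d_def q_def)
  \<comment> \<open>Forced by the exponent \<open>(y - 1) * (q / 2)\<close> below. For this
    \<open>b\<close> the exponential moment is (1 + q/d)^(d/2) <= exp (q/2), which cancels the
    factor \<open>exp (- q / 2)\<close>.\<close>
  define b where "b = q / (q + d)"
  have b: "b < 1" "1 - b = d / (q + d)" using d q by (simp_all add: b_def field_simps)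
  have "(1 - b) powr (- d / 2) = (1 + q / d) powr (d / 2)"
    unfolding b(2) using d q by (simp add: powr_minus powr_divide field_simps)
  also have "\<dots> \<le> exp (q / d) powr (d / 2)"
    using d q exp_ge_add_one_self[of "q / d"] by (intro powr_mono2) auto
  also have "\<dots> = exp (q / 2)" using d by (simp add: exp_powr_real)
  finally have exp_le: "(1 - b) powr (- d / 2) \<le> exp (q / 2)" .
  have "(\<integral>u. norm u ^ n \<partial>(std_gaussian :: 'a measure))
      \<le> (\<integral>u. (q + d) powr (q / 2) * exp (- q / 2) * exp (b * (norm u)\<^sup>2 / 2) \<partial>(std_gaussian :: 'a measure))"
  proof (intro integral_mono integrable_std_gaussian_norm_power integrable_mult_right
      integrable_std_gaussian_exp_square b)
    fix u :: 'a
    show "norm u ^ n \<le> (q + d) powr (q / 2) * exp (- q / 2) * exp (b * (norm u)\<^sup>2 / 2)"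
    proof (cases "u = 0")
      \<comment> \<open>Separate because \<open>0 powr 0 = 0\<close> while
        \<open>0 ^ 0 = 1\<close>.\<close>
      case True
      then show ?thesis using d q by (cases "n = 0") (auto simp: q_def power_0_left)
    next
      case False
      define y where "y = (norm u)\<^sup>2 / (q + d)"
      have "y \<le> exp (y - 1)" using exp_ge_add_one_self[of "y - 1"] by simp
      moreover have "(norm u)\<^sup>2 = (q + d) * y" using d q by (simp add: y_def)
      ultimately have "(norm u)\<^sup>2 \<le> (q + d) * exp (y - 1)" using d q by simp
      then have "((norm u)\<^sup>2) powr (q / 2) \<le> ((q + d) * exp (y - 1)) powr (q / 2)"
        using q by (intro powr_mono2) auto
      also have "\<dots> = (q + d) powr (q / 2) * exp ((y - 1) * (q / 2))"
        using d q by (simp add: powr_mult exp_powr_real)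
      also have "(y - 1) * (q / 2) = - q / 2 + b * (norm u)\<^sup>2 / 2"
        by (simp add: y_def b_def algebra_simps)
      also have "((norm u)\<^sup>2) powr (q / 2) = norm u ^ n"
        using False powr_powr[of "norm u" 2 "q / 2"] by (simp add: q_def powr_realpow)
      finally show ?thesis by (simp only: exp_add mult.assoc)
    qed
  qed
  also have "\<dots> = (q + d) powr (q / 2) * exp (- q / 2) * (1 - b) powr (- d / 2)"
    using integral_std_gaussian_exp_square[OF b(1), where 'a='a] by (simp add: d_def)
  also have "\<dots> \<le> (q + d) powr (q / 2) * exp (- q / 2) * exp (q / 2)"
    by (intro mult_left_mono exp_le) auto
  finally show ?thesis
    by (simp add: mult.assoc d_def q_def flip: exp_add)
qed

text \<open>\<open>std_gaussian_norm_moment_le\<close> would only give d + 2, and the constants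
  contain sqrt d. From exp x >= 1 + x, the mean E of the squared norm satisfies 1 + b E / 2 <= (1 -
  b)^(-d/2); dividing by \<open>b\<close> and letting \<open>b\<close> tend to 0 from the right
  leaves the derivative d / 2.\<close>

lemma std_gaussian_norm_square_le:
  "(\<integral>u. (norm u)\<^sup>2 \<partial>(std_gaussian :: 'a::euclidean_space measure)) \<le> real DIM('a)"
proof -
  define d where "d = real DIM('a)"
  define E where "E = (\<integral>u. (norm u)\<^sup>2 \<partial>(std_gaussian :: 'a measure))"
  have le: "E \<le> 2 * (((1 - b) powr (- d / 2) - 1) / b)" if b: "0 < b" "b < 1" for b
  proof -
    have "1 + b / 2 * E = (\<integral>u. 1 + b / 2 * (norm u)\<^sup>2 \<partial>(std_gaussian :: 'a measure))"
      using integrable_std_gaussian_norm_power[of 2, where 'a='a] std_gaussian.prob_space[where 'a='a]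
      by (simp add: E_def)
    also have "\<dots> \<le> (\<integral>u. exp (b * (norm u)\<^sup>2 / 2) \<partial>(std_gaussian :: 'a measure))"
      using integrable_std_gaussian_norm_power[of 2, where 'a='a]
        integrable_std_gaussian_exp_square[OF b(2), where 'a='a]
      by (intro integral_mono) (auto intro: exp_ge_add_one_self[THEN order_trans[rotated]])
    also have "\<dots> = (1 - b) powr (- d / 2)"
      using integral_std_gaussian_exp_square[OF b(2), where 'a='a] by (simp add: d_def)
    finally show ?thesis using b by (simp add: field_simps)
  qed
  have "((\<lambda>b. (1 - b) powr (- d / 2)) has_real_derivative d / 2) (at 0)"
    by (auto intro!: derivative_eq_intros)
  then have "((\<lambda>b. ((1 - b) powr (- d / 2) - 1) / b) \<longlongrightarrow> d / 2) (at 0)"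
    by (simp add: has_field_derivative_iff)
  then have "((\<lambda>b. ((1 - b) powr (- d / 2) - 1) / b) \<longlongrightarrow> d / 2) (at_right 0)"
    by (rule filterlim_mono) (auto simp: at_le)
  then have "((\<lambda>b. 2 * (((1 - b) powr (- d / 2) - 1) / b)) \<longlongrightarrow> 2 * (d / 2)) (at_right 0)"
    by (rule tendsto_mult[OF tendsto_const])
  moreover have "\<forall>\<^sub>F b in at_right (0::real). E \<le> 2 * (((1 - b) powr (- d / 2) - 1) / b)"
    unfolding eventually_at_right_field by (intro exI[of _ 1]) (use le in auto)
  ultimately have "E \<le> 2 * (d / 2)"
    by (intro tendsto_lowerbound) auto
  then show ?thesis by (simp add: E_def d_def)
qed

text \<open>Jensen's inequality in the form of its tangent line: t <= t^2 / (2 r) + r / 2, with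
  equality at t = r = sqrt d.\<close>

lemma std_gaussian_norm_le:
  "(\<integral>u. norm u \<partial>(std_gaussian :: 'a::euclidean_space measure)) \<le> sqrt (real DIM('a))"
proof -
  define r where "r = sqrt (real DIM('a))"
  have r: "r > 0" by (simp add: r_def)
  have "(\<integral>u. norm u \<partial>(std_gaussian :: 'a measure))
      \<le> (\<integral>u. 1 / (2 * r) * (norm u)\<^sup>2 + r / 2 \<partial>(std_gaussian :: 'a measure))"
  proof (rule integral_mono)
    show "norm u \<le> 1 / (2 * r) * (norm u)\<^sup>2 + r / 2" for u :: 'a
      using r zero_le_power2[of "norm u - r"] by (simp add: field_simps power2_eq_square)
  qed (use integrable_std_gaussian_norm_power[where 'a='a, of 1]
      integrable_std_gaussian_norm_power[where 'a='a, of 2] in auto)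
  also have "\<dots> = 1 / (2 * r) * (\<integral>u. (norm u)\<^sup>2 \<partial>(std_gaussian :: 'a measure)) + r / 2"
    using integrable_std_gaussian_norm_power[where 'a='a, of 2] std_gaussian.prob_space[where 'a='a]
    by simp
  also have "\<dots> \<le> 1 / (2 * r) * r\<^sup>2 + r / 2"
    using std_gaussian_norm_square_le[where 'a='a] r
    by (intro add_right_mono mult_left_mono) (auto simp: r_def)
  also have "\<dots> = r" using r by (simp add: power2_eq_square)
  finally show ?thesis by (simp add: r_def)
qed

section \<open>Differentiability of the Gaussian smoothing\<close>

text \<open>Cameron-Martin formula: a translation by \<open>w\<close> becomes an exponential weight,
  by expanding the square in the shifted density.\<close>

lemma integral_std_gaussian_translate:
  fixes g :: "'a::euclidean_space \<Rightarrow> 'b::{banach, second_countable_topology}"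
  assumes [measurable]: "g \<in> borel_measurable borel"
  shows "(\<integral>u. g (u + w) \<partial>std_gaussian)
    = (\<integral>u. exp (u \<bullet> w - (norm w)\<^sup>2 / 2) *\<^sub>R g u \<partial>std_gaussian)"
proof -
  define c where "c = (2 * pi) powr (- real DIM('a) / 2)"
  have c: "c \<ge> 0" by (simp add: c_def)
  define \<phi> where "\<phi> u = c * exp (- (norm u)\<^sup>2 / 2)" for u :: 'a
  have [measurable]: "\<phi> \<in> borel_measurable borel" by (simp add: \<phi>_def[abs_def])
  have dens: "(\<integral>u. h u \<partial>std_gaussian) = (\<integral>u. \<phi> u *\<^sub>R h u \<partial>lborel)"
    if [measurable]: "h \<in> borel_measurable borel" for h :: "'a \<Rightarrow> 'b"
    unfolding std_gaussian_def c_def[symmetric] \<phi>_def[symmetric]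
    by (rule integral_density) (auto simp: \<phi>_def c)
  have "(\<integral>u. g (u + w) \<partial>std_gaussian) = (\<integral>u. \<phi> u *\<^sub>R g (u + w) \<partial>lborel)"
    by (rule dens) measurable
  also have "\<dots> = (\<integral>u. \<phi> ((w + u) - w) *\<^sub>R g (w + u) \<partial>lborel)"
    by (simp add: add.commute)
  also have "\<dots> = (\<integral>u. \<phi> (u - w) *\<^sub>R g u \<partial>distr lborel borel ((+) w))"
    by (subst integral_distr) auto
  also have "\<dots> = (\<integral>u. \<phi> (u - w) *\<^sub>R g u \<partial>lborel)"
    by (simp add: lborel_distr_plus)
  also have "\<dots> = (\<integral>u. \<phi> u *\<^sub>R exp (u \<bullet> w - (norm w)\<^sup>2 / 2) *\<^sub>R g u \<partial>lborel)"
  proof (rule Bochner_Integration.integral_cong)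
    fix u :: 'a
    have "- (norm (u - w))\<^sup>2 / 2 = - (norm u)\<^sup>2 / 2 + (u \<bullet> w - (norm w)\<^sup>2 / 2)"
      by (simp add: power2_norm_eq_inner inner_diff_left inner_diff_right inner_commute field_simps)
    then have "\<phi> (u - w) = \<phi> u * exp (u \<bullet> w - (norm w)\<^sup>2 / 2)"
      by (simp only: \<phi>_def exp_add mult.assoc)
    then show "\<phi> (u - w) *\<^sub>R g u = \<phi> u *\<^sub>R exp (u \<bullet> w - (norm w)\<^sup>2 / 2) *\<^sub>R g u" by simp
  qed simp
  also have "\<dots> = (\<integral>u. exp (u \<bullet> w - (norm w)\<^sup>2 / 2) *\<^sub>R g u \<partial>std_gaussian)"
    by (rule dens[symmetric]) measurable
  finally show ?thesis .
qed

lemma abs_exp_minus_taylor1_le: "\<bar>exp s - 1 - s\<bar> \<le> s\<^sup>2 / 2 * exp \<bar>s\<bar>" for s :: real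
proof -
  obtain t where t: "\<bar>t\<bar> \<le> \<bar>s\<bar>" "exp s = (\<Sum>i<2. s ^ i / fact i) + exp t / fact 2 * s ^ 2"
    using Maclaurin_exp_le[of s 2] by blast
  have "\<bar>exp s - 1 - s\<bar> = s\<^sup>2 / 2 * exp t"
    using t(2) by (simp add: eval_nat_numeral abs_mult)
  also have "\<dots> \<le> s\<^sup>2 / 2 * exp \<bar>s\<bar>"
    using t(1) by (intro mult_left_mono) auto
  finally show ?thesis .
qed

text \<open>Supplies the dominating function for differentiation under the integral: quadratic in
  \<open>w\<close>, with a weight in \<open>u\<close> that does not depend on \<open>w\<close>. The
  term \<open>(norm w)\<^sup>2 / 2\<close> of the exponent is itself of second order.\<close>

lemma exp_translate_taylor_bound:
  fixes u w :: "'a::euclidean_space"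
  assumes w: "norm w \<le> 1"
  shows "\<bar>exp (u \<bullet> w - (norm w)\<^sup>2 / 2) - 1 - u \<bullet> w\<bar> \<le> (norm w)\<^sup>2 * (2 * exp (2 * (norm u + 1)))"
proof -
  define s where "s = u \<bullet> w - (norm w)\<^sup>2 / 2"
  define r where "r = norm u + 1"
  have r: "r \<ge> 1" by (simp add: r_def)
  have "\<bar>s\<bar> \<le> norm u * norm w + norm w * norm w / 2"
    using Cauchy_Schwarz_ineq2[of u w] zero_le_square[of "norm w"]
    unfolding s_def power2_eq_square by linarith
  also have "\<dots> \<le> norm u * norm w + 1 * norm w"
    using mult_right_mono[OF w norm_ge_zero[of w]] norm_ge_zero[of w] by linarith
  also have "\<dots> = norm w * r" by (simp add: r_def algebra_simps)
  finally have s: "\<bar>s\<bar> \<le> norm w * r" .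
  moreover have "norm w * r \<le> 1 * r" using w r by (intro mult_right_mono) auto
  ultimately have sr: "\<bar>s\<bar> \<le> r" by simp
  have "s\<^sup>2 \<le> (norm w * r)\<^sup>2" using s by (simp add: abs_le_square_iff[symmetric])
  then have "s\<^sup>2 / 2 * exp \<bar>s\<bar> \<le> (norm w)\<^sup>2 * (r\<^sup>2 / 2) * exp r"
    using sr by (intro mult_mono) (auto simp: power_mult_distrib)
  also have "\<dots> \<le> (norm w)\<^sup>2 * exp r * exp r"
    using power_le_fact_exp[of r 2] r by (intro mult_right_mono mult_left_mono) (auto simp: fact_2)
  also have "\<dots> = (norm w)\<^sup>2 * exp (2 * r)"
    by (simp add: mult.assoc flip: exp_add)
  finally have "\<bar>exp s - 1 - s\<bar> \<le> (norm w)\<^sup>2 * exp (2 * r)"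
    using abs_exp_minus_taylor1_le[of s] by linarith
  moreover have "\<bar>exp s - 1 - u \<bullet> w\<bar> \<le> \<bar>exp s - 1 - s\<bar> + (norm w)\<^sup>2 / 2"
    using zero_le_power2[of "norm w"] unfolding s_def by linarith
  moreover have "(norm w)\<^sup>2 / 2 \<le> (norm w)\<^sup>2 * exp (2 * r)"
  proof -
    have "1 / 2 \<le> exp (2 * r)" using exp_ge_add_one_self[of "2 * r"] r by linarith
    from mult_left_mono[OF this, of "(norm w)\<^sup>2"] show ?thesis by simp
  qed
  ultimately have "\<bar>exp s - 1 - u \<bullet> w\<bar> \<le> (norm w)\<^sup>2 * exp (2 * r) + (norm w)\<^sup>2 * exp (2 * r)"
    by linarith
  then show ?thesis by (simp add: s_def r_def)
qed

text \<open>Translating the Gaussian instead of \<open>g\<close> lets the smooth density be differentiated, so \<open>g\<close> itself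
  only has to be measurable.\<close>

lemma GDERIV_gauss_smooth:
  fixes g :: "'a::euclidean_space \<Rightarrow> real"
  assumes [measurable]: "g \<in> borel_measurable borel"
    and growth: "\<And>y. \<bar>g y\<bar> \<le> K * exp (c * norm y)" and c: "c \<ge> 0" and \<sigma>: "\<sigma> > 0"
  shows "GDERIV (gauss_smooth g \<sigma>) x :> (1 / \<sigma>) *\<^sub>R (\<integral>u. g (x + \<sigma> *\<^sub>R u) *\<^sub>R u \<partial>std_gaussian)"
proof -
  define G where "G u = g (x + \<sigma> *\<^sub>R u)" for u
  have [measurable]: "G \<in> borel_measurable borel" unfolding G_def[abs_def] by measurable
  define K' where "K' = K * exp (c * norm x)"
  define c' where "c' = c * \<sigma>"
  have K: "K \<ge> 0" using growth[of 0] abs_ge_zero order_trans by fastforce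
  then have K': "K' \<ge> 0" by (simp add: K'_def)
  have G: "\<bar>G u\<bar> \<le> K' * exp (c' * norm u)" for u
  proof -
    have "c * norm (x + \<sigma> *\<^sub>R u) \<le> c * norm x + c' * norm u"
      using mult_left_mono[OF norm_triangle_ineq[of x "\<sigma> *\<^sub>R u"] c] \<sigma>
      by (simp add: c'_def algebra_simps)
    then have "K * exp (c * norm (x + \<sigma> *\<^sub>R u)) \<le> K * exp (c * norm x + c' * norm u)"
      using K by (intro mult_left_mono) auto
    then show ?thesis
      using growth[of "x + \<sigma> *\<^sub>R u"] by (simp add: G_def K'_def exp_add)
  qed
  have int_G: "integrable std_gaussian G"
    using G by (intro integrable_std_gaussian_exp_growth[where K=K' and c=c']) auto
  have int_Gu: "integrable std_gaussian (\<lambda>u. G u *\<^sub>R u)"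
  proof (rule integrable_std_gaussian_exp_growth)
    fix u :: 'a
    have "norm (G u *\<^sub>R u) \<le> (K' * exp (c' * norm u)) * exp (norm u)"
      using G[of u] power_le_fact_exp[of "norm u" 1] K' by (simp add: mult_mono)
    then show "norm (G u *\<^sub>R u) \<le> K' * exp ((c' + 1) * norm u)"
      by (simp add: algebra_simps exp_add)
  qed measurable
  have int_shift: "integrable std_gaussian (\<lambda>u. exp (u \<bullet> w - (norm w)\<^sup>2 / 2) *\<^sub>R G u)" for w
  proof (rule integrable_std_gaussian_exp_growth)
    fix u :: 'a
    have "u \<bullet> w - (norm w)\<^sup>2 / 2 \<le> norm w * norm u"
      using norm_cauchy_schwarz[of u w] zero_le_power2[of "norm w"] unfolding mult.commute[of "norm w"] by linarith
    then have "exp (u \<bullet> w - (norm w)\<^sup>2 / 2) * \<bar>G u\<bar> \<le> exp (norm w * norm u) * (K' * exp (c' * norm u))"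
      using G[of u] K' by (intro mult_mono) auto
    then show "norm (exp (u \<bullet> w - (norm w)\<^sup>2 / 2) *\<^sub>R G u) \<le> K' * exp ((norm w + c') * norm u)"
      by (simp add: algebra_simps exp_add abs_mult)
  qed measurable
  define Q where "Q u = 2 * exp (2 * (norm u + 1)) * \<bar>G u\<bar>" for u
  have int_Q: "integrable std_gaussian Q"
  proof (rule integrable_std_gaussian_exp_growth)
    fix u :: 'a
    have "Q u \<le> 2 * exp (2 * (norm u + 1)) * (K' * exp (c' * norm u))"
      unfolding Q_def using G[of u] by (intro mult_left_mono) auto
    then show "norm (Q u) \<le> (2 * K' * exp 2) * exp ((2 + c') * norm u)"
      by (simp add: Q_def algebra_simps exp_add)
  next
    show "Q \<in> borel_measurable borel" unfolding Q_def[abs_def] by measurable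
  qed
  define I where "I = (\<integral>u. Q u \<partial>std_gaussian)"
  define D where "D = (1 / \<sigma>) *\<^sub>R (\<integral>u. G u *\<^sub>R u \<partial>std_gaussian)"
  have shift: "gauss_smooth g \<sigma> (x + h)
      = (\<integral>u. exp (u \<bullet> w - (norm w)\<^sup>2 / 2) *\<^sub>R G u \<partial>std_gaussian)" if "h = \<sigma> *\<^sub>R w" for h w
  proof -
    have "gauss_smooth g \<sigma> (x + h) = (\<integral>u. G (u + w) \<partial>std_gaussian)"
      by (simp add: gauss_smooth_def G_def that algebra_simps)
    then show ?thesis by (simp add: integral_std_gaussian_translate)
  qed
  \<comment> \<open>Moving \<open>x\<close> by \<open>h\<close> is a Gaussian translation by
    \<open>w = h / \<sigma>\<close>, so the restriction on \<open>h\<close> says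
    \<open>norm w \<le> 1\<close>. A quadratic remainder gives the Frechet derivative at
    once.\<close>
  have bound: "norm (gauss_smooth g \<sigma> (x + h) - gauss_smooth g \<sigma> x - h \<bullet> D) \<le> I / \<sigma>\<^sup>2 * (norm h)\<^sup>2"
    if h: "norm h \<le> \<sigma>" for h
  proof -
    define w where "w = (1 / \<sigma>) *\<^sub>R h"
    have hw: "h = \<sigma> *\<^sub>R w" and nw: "norm w = norm h / \<sigma>" using \<sigma> by (simp_all add: w_def)
    have hD: "h \<bullet> D = (\<integral>u. w \<bullet> (G u *\<^sub>R u) \<partial>std_gaussian)"
      unfolding D_def w_def using \<sigma> int_Gu by (subst integral_inner_right) auto
    have int_wGu: "integrable std_gaussian (\<lambda>u. w \<bullet> (G u *\<^sub>R u))"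
      using int_Gu by (intro integrable_inner_right)
    from hD have "gauss_smooth g \<sigma> (x + h) - gauss_smooth g \<sigma> x - h \<bullet> D
        = (\<integral>u. exp (u \<bullet> w - (norm w)\<^sup>2 / 2) *\<^sub>R G u \<partial>std_gaussian) - (\<integral>u. G u \<partial>std_gaussian)
          - (\<integral>u. w \<bullet> (G u *\<^sub>R u) \<partial>std_gaussian)"
      using shift[of 0 0] by (simp add: shift[OF hw])
    also have "\<dots> = (\<integral>u. exp (u \<bullet> w - (norm w)\<^sup>2 / 2) *\<^sub>R G u - G u - w \<bullet> (G u *\<^sub>R u) \<partial>std_gaussian)"
      using Bochner_Integration.integral_diff[OF int_shift int_G, of w]
        Bochner_Integration.integral_diff[OF Bochner_Integration.integrable_diff[OF int_shift int_G, of w] int_wGu]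
      by simp
    also have "\<dots> = (\<integral>u. (exp (u \<bullet> w - (norm w)\<^sup>2 / 2) - 1 - u \<bullet> w) * G u \<partial>std_gaussian)"
      by (simp add: algebra_simps inner_commute)
    finally have "norm (gauss_smooth g \<sigma> (x + h) - gauss_smooth g \<sigma> x - h \<bullet> D)
        = norm (\<integral>u. (exp (u \<bullet> w - (norm w)\<^sup>2 / 2) - 1 - u \<bullet> w) * G u \<partial>std_gaussian)" by simp
    also have "\<dots> \<le> (\<integral>u. (norm w)\<^sup>2 * Q u \<partial>std_gaussian)"
    proof (rule Bochner_Integration.integral_norm_bound_integral)
      have "integrable std_gaussian (\<lambda>u. exp (u \<bullet> w - (norm w)\<^sup>2 / 2) *\<^sub>R G u - G u - w \<bullet> (G u *\<^sub>R u))"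
        by (intro Bochner_Integration.integrable_diff int_shift int_G int_wGu)
      then show "integrable std_gaussian (\<lambda>u. (exp (u \<bullet> w - (norm w)\<^sup>2 / 2) - 1 - u \<bullet> w) * G u)"
        by (simp add: algebra_simps inner_commute)
      show "integrable std_gaussian (\<lambda>u. (norm w)\<^sup>2 * Q u)" using int_Q by simp
      fix u :: 'a
      have "norm w \<le> 1" using h \<sigma> nw by simp
      from mult_right_mono[OF exp_translate_taylor_bound[OF this, of u] abs_ge_zero[of "G u"]]
      show "norm ((exp (u \<bullet> w - (norm w)\<^sup>2 / 2) - 1 - u \<bullet> w) * G u) \<le> (norm w)\<^sup>2 * Q u"
        by (simp add: Q_def abs_mult mult.assoc)
    qed
    also have "\<dots> = I / \<sigma>\<^sup>2 * (norm h)\<^sup>2" by (simp add: I_def nw power_divide)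
    finally show ?thesis .
  qed
  have "(gauss_smooth g \<sigma> has_derivative (\<lambda>h. h \<bullet> D)) (at x)"
    unfolding has_derivative_at
  proof
    show "bounded_linear (\<lambda>h. h \<bullet> D)" by (rule bounded_linear_inner_left)
    show "(\<lambda>h. norm (gauss_smooth g \<sigma> (x + h) - gauss_smooth g \<sigma> x - h \<bullet> D) / norm h) \<midarrow>0\<rightarrow> 0"
    proof (rule Lim_null_comparison)
      show "((\<lambda>h::'a. I / \<sigma>\<^sup>2 * norm h) \<longlongrightarrow> 0) (at 0)"
        using \<sigma> by (auto intro!: tendsto_eq_intros)
      show "\<forall>\<^sub>F h in at 0. norm (norm (gauss_smooth g \<sigma> (x + h) - gauss_smooth g \<sigma> x - h \<bullet> D) / norm h)
          \<le> I / \<sigma>\<^sup>2 * norm h"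
        unfolding eventually_at
      proof (intro exI[of _ \<sigma>] conjI ballI impI \<sigma>)
        fix h :: 'a assume h: "h \<noteq> 0 \<and> dist h 0 < \<sigma>"
        then have "norm (gauss_smooth g \<sigma> (x + h) - gauss_smooth g \<sigma> x - h \<bullet> D) / norm h
            \<le> I / \<sigma>\<^sup>2 * (norm h)\<^sup>2 / norm h"
          by (intro divide_right_mono bound) auto
        then show "norm (norm (gauss_smooth g \<sigma> (x + h) - gauss_smooth g \<sigma> x - h \<bullet> D) / norm h)
            \<le> I / \<sigma>\<^sup>2 * norm h"
          using h by (simp add: power2_eq_square)
      qed
    qed
  qed
  then show ?thesis by (simp add: gderiv_def D_def G_def)
qed

lemma GDERIV_unique:
  assumes "GDERIV g x :> D" "GDERIV g x :> D'"
  shows "D = D'"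
proof -
  have "(\<lambda>h. h \<bullet> D) = (\<lambda>h. h \<bullet> D')"
    using assms unfolding gderiv_def by (rule has_derivative_unique)
  then have "(D - D') \<bullet> (D - D') = 0" by (metis inner_diff_right right_minus_eq)
  then show ?thesis by simp
qed

lemma grad_eqI: "GDERIV g x :> D \<Longrightarrow> grad g x = D"
  unfolding grad_def by (blast intro: GDERIV_unique)

text \<open>Smoothing the constant 1 returns a constant; the gradient formula then writes the zero
  gradient as the mean of \<open>u\<close>.\<close>

lemma integral_std_gaussian_mean: "(\<integral>u. u \<partial>(std_gaussian :: 'a::euclidean_space measure)) = 0"
proof -
  have "gauss_smooth (\<lambda>_. 1) 1 = (\<lambda>_ :: 'a. 1)"
    using std_gaussian.prob_space by (simp add: gauss_smooth_def fun_eq_iff)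
  then have "GDERIV (\<lambda>_ :: 'a. 1 :: real) 0 :> (\<integral>u. u \<partial>std_gaussian)"
    using GDERIV_gauss_smooth[of "\<lambda>_ :: 'a. 1" 1 0 1 0] by simp
  from GDERIV_unique[OF this GDERIV_const] show ?thesis .
qed

section \<open>The descent inequality\<close>

lemma card_mult_power_sum_le:
  fixes a :: "'i \<Rightarrow> real"
  assumes I: "finite I" "I \<noteq> {}" and a: "\<And>i. i \<in> I \<Longrightarrow> a i \<ge> 0"
  shows "real (card I) * (\<Sum>i\<in>I. a i) ^ n \<le> real (card I) ^ n * (\<Sum>i\<in>I. a i ^ n)"
proof -
  define N where "N = real (card I)"
  have N: "N > 0" using I by (simp add: N_def card_gt_0_iff)
  have "convex_on {0::real..} (\<lambda>x. x ^ n)"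
    by (cases "even n") (auto intro: convex_power_odd convex_on_subset[OF convex_power_even])
  then have "(\<Sum>i\<in>I. (1 / N) *\<^sub>R a i) ^ n \<le> (\<Sum>i\<in>I. 1 / N * a i ^ n)"
    using I a N by (intro convex_on_sum) (auto simp: N_def)
  then have "((\<Sum>i\<in>I. a i) / N) ^ n \<le> (\<Sum>i\<in>I. a i ^ n) / N"
    by (simp flip: sum_divide_distrib)
  \<comment> \<open>Jensen for equal weights is multiplied out so that the exponent n - 1 is
    avoided; at \<open>n = 0\<close> both sides equal the cardinality.\<close>
  then have "N * N ^ n * ((\<Sum>i\<in>I. a i) / N) ^ n \<le> N * N ^ n * ((\<Sum>i\<in>I. a i ^ n) / N)"
    using N by (intro mult_left_mono) auto
  then show ?thesis using N by (simp add: power_divide N_def)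
qed

text \<open>The real exponent keeps the bound correct, and an equality, at \<open>n = 0\<close>: 1 =
  2^(-1) * 2. This is how the factor 2^(m-1) covers m = 0.\<close>

lemma power_add_le:
  fixes a b :: real
  assumes "a \<ge> 0" "b \<ge> 0"
  shows "(a + b) ^ n \<le> 2 powr (real n - 1) * (a ^ n + b ^ n)"
proof -
  have "2 * (a + b) ^ n \<le> 2 ^ n * (a ^ n + b ^ n)"
    using card_mult_power_sum_le[of "UNIV :: bool set" "\<lambda>i. if i then a else b" n] assms
    by (simp add: UNIV_bool add.commute)
  then show ?thesis by (simp add: powr_diff powr_realpow)
qed

lemma power_add3_le:
  fixes a b c :: real
  assumes "a \<ge> 0" "b \<ge> 0" "c \<ge> 0" "n > 0"
  shows "(a + b + c) ^ n \<le> 3 ^ (n - 1) * (a ^ n + b ^ n + c ^ n)"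
proof -
  have "3 * (a + b + c) ^ n \<le> 3 ^ n * (a ^ n + b ^ n + c ^ n)"
    using card_mult_power_sum_le[of "{..<3::nat}" "\<lambda>i. if i = 0 then a else if i = 1 then b else c" n] assms
    by (simp add: numeral_3_eq_3 lessThan_Suc add_ac)
  then show ?thesis using assms(4) by (cases n) auto
qed

lemma isCont_of_norm_diff_le:
  fixes g :: "'a::real_normed_vector \<Rightarrow> 'b::real_normed_vector"
  assumes "r > 0" "\<And>y. norm (y - x) < r \<Longrightarrow> norm (g y - g x) \<le> L * norm (y - x)"
  shows "isCont g x"
proof -
  have "((\<lambda>y. g y - g x) \<longlongrightarrow> 0) (at x)"
  proof (rule Lim_null_comparison)
    show "((\<lambda>y. L * norm (y - x)) \<longlongrightarrow> 0) (at x)"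
      by (auto intro!: tendsto_eq_intros)
    show "\<forall>\<^sub>F y in at x. norm (g y - g x) \<le> L * norm (y - x)"
      unfolding eventually_at using assms by (auto simp: dist_norm)
  qed
  then show ?thesis by (simp add: isCont_def Lim_null[symmetric])
qed

text \<open>Applied with \<open>s\<close> = \<open>norm x ^ m\<close>, this makes the normalised
  moment of order m + 2 bounded independently of \<open>x\<close>. The induction step rests on s^n
  (s - 1)^2 >= 0.\<close>

lemma power_plus_one_le_power:
  fixes s :: real
  assumes s: "s \<ge> 0"
  shows "s ^ (m + 2) + 1 \<le> (s\<^sup>2 + 1) ^ (m + 2)"
proof (induction m)
  case 0
  have "1 * (s\<^sup>2 + 1) \<le> (s\<^sup>2 + 1) * (s\<^sup>2 + 1)" by (intro mult_right_mono) auto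
  then show ?case by (simp add: power2_eq_square)
next
  case (Suc m)
  have "0 \<le> s ^ (m + 2) * (s - 1)\<^sup>2" using s by simp
  also have "\<dots> = s ^ (m + 2) * s\<^sup>2 + s ^ (m + 2) - 2 * s ^ (Suc m + 2)"
    by (simp add: power2_diff algebra_simps power2_eq_square)
  finally have "s ^ (Suc m + 2) + 1 \<le> (s ^ (m + 2) + 1) * (s\<^sup>2 + 1) - s ^ (Suc m + 2) - s\<^sup>2"
    by (simp add: algebra_simps)
  also have "\<dots> \<le> (s ^ (m + 2) + 1) * (s\<^sup>2 + 1)"
    using zero_le_power[OF s, of "Suc m + 2"] zero_le_power2[of s] by linarith
  also have "\<dots> \<le> (s\<^sup>2 + 1) ^ (m + 2) * (s\<^sup>2 + 1)"
    using Suc.IH by (intro mult_right_mono) auto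
  finally show ?case by (simp add: mult.commute)
qed

section \<open>Smoothing and search direction under a Lipschitz bound growing polynomially with the
  radius\<close>

locale poly_lipschitz =
  fixes f :: "'a::euclidean_space \<Rightarrow> real" and R1 R2 \<sigma> :: real and m :: nat
  assumes R1: "R1 \<ge> 0" and R2: "R2 \<ge> 0" and sigma_pos: "\<sigma> > 0"
    and lip: "\<And>x y N. norm x \<le> N \<Longrightarrow> norm y \<le> N \<Longrightarrow> \<bar>f x - f y\<bar> \<le> (R1 * N ^ m + R2) * norm (x - y)"
begin

abbreviation fs :: "'a \<Rightarrow> real" where "fs \<equiv> gauss_smooth f \<sigma>"

definition zo_dir :: "'a \<Rightarrow> 'a \<Rightarrow> 'a" where
  "zo_dir x u = ((f (x + \<sigma> *\<^sub>R u) - f x) / \<sigma>) *\<^sub>R u"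

definition A :: real where
  "A = 2 powr (2 * real m - 2) * R1 * \<sigma> powr (real m - 1)
         * (real m + 1 + real DIM('a)) powr ((real m + 1) / 2)
       + R2 * sqrt (real DIM('a)) / \<sigma>"

definition B :: real where
  "B = 2 powr (2 * real m - 2) * R1 * sqrt (real DIM('a)) / \<sigma>"

definition C :: real where
  "C = 2 powr (real m - 1) * R1 * sqrt (real DIM('a)) / \<sigma>"

definition H :: "nat \<Rightarrow> real" where "H = H_const R1 R2 m \<sigma> DIM('a)"

lemma A_nonneg: "A \<ge> 0" and B_nonneg: "B \<ge> 0" and C_nonneg: "C \<ge> 0"
  using R1 R2 sigma_pos by (simp_all add: A_def B_def C_def)

lemma increment_le:
  "\<bar>f (x + h) - f x\<bar> \<le> (2 powr (real m - 1) * R1 * (norm x ^ m + norm h ^ m) + R2) * norm h"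
proof -
  have "\<bar>f (x + h) - f x\<bar> \<le> (R1 * (norm x + norm h) ^ m + R2) * norm (x + h - x)"
    by (rule lip) (auto intro: norm_triangle_ineq)
  also have "\<dots> \<le> (R1 * (2 powr (real m - 1) * (norm x ^ m + norm h ^ m)) + R2) * norm h"
    using R1 by (auto intro!: mult_right_mono mult_left_mono power_add_le)
  finally show ?thesis by (simp add: mult_ac)
qed

lemma isCont_f: "isCont f x"
proof (rule isCont_of_norm_diff_le[of 1])
  fix y assume "norm (y - x) < 1"
  moreover have "norm y \<le> norm x + norm (y - x)" by norm
  ultimately show "norm (f y - f x) \<le> (R1 * (norm x + 1) ^ m + R2) * norm (y - x)"
    unfolding real_norm_def by (intro lip) auto
qed simp

lemma borel_measurable_f [measurable]: "f \<in> borel_measurable borel"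
  by (intro borel_measurable_continuous_onI) (simp add: continuous_at_imp_continuous_on isCont_f)

text \<open>The growth of degree m + 1 is relaxed to an exponential so that the integrability and
  differentiation lemmas apply; the exponent \<open>1 * norm y\<close> matches their parameter
  \<open>c\<close>.\<close>

lemma exp_growth: "\<bar>f y\<bar> \<le> (\<bar>f 0\<bar> + R1 * fact (m + 1) + R2) * exp (1 * norm y)"
proof -
  define t where "t = norm y"
  have t: "t \<ge> 0" by (simp add: t_def)
  have "\<bar>f y - f 0\<bar> \<le> (R1 * t ^ m + R2) * t"
    using lip[of y t 0] by (simp add: t_def)
  also have "\<dots> = R1 * t ^ (m + 1) + R2 * t ^ 1" by (simp add: algebra_simps)
  also have "\<dots> \<le> R1 * (fact (m + 1) * exp t) + R2 * (fact 1 * exp t)"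
    using R1 R2 t by (intro add_mono mult_left_mono power_le_fact_exp) auto
  finally have "\<bar>f y - f 0\<bar> \<le> (R1 * fact (m + 1) + R2) * exp t" by (simp add: algebra_simps)
  moreover have "\<bar>f 0\<bar> * 1 \<le> \<bar>f 0\<bar> * exp t" using t by (intro mult_left_mono) auto
  moreover have "\<bar>f y\<bar> \<le> \<bar>f 0\<bar> + \<bar>f y - f 0\<bar>" by linarith
  ultimately show ?thesis by (simp add: t_def algebra_simps)
qed

lemma GDERIV_fs_raw:
  "GDERIV fs x :> (1 / \<sigma>) *\<^sub>R (\<integral>u. f (x + \<sigma> *\<^sub>R u) *\<^sub>R u \<partial>std_gaussian)"
  by (rule GDERIV_gauss_smooth[OF _ exp_growth]) (auto simp: sigma_pos)

lemma GDERIV_fs: "GDERIV fs x :> grad fs x"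
  using GDERIV_fs_raw grad_eqI by metis

lemma sample_exp_growth:
  "\<bar>f (x + \<sigma> *\<^sub>R u)\<bar> \<le> (\<bar>f 0\<bar> + R1 * fact (m + 1) + R2) * exp (norm x) * exp (\<sigma> * norm u)"
proof -
  have "\<bar>f (x + \<sigma> *\<^sub>R u)\<bar> \<le> (\<bar>f 0\<bar> + R1 * fact (m + 1) + R2) * exp (norm (x + \<sigma> *\<^sub>R u))"
    using exp_growth[of "x + \<sigma> *\<^sub>R u"] by simp
  also have "\<dots> \<le> (\<bar>f 0\<bar> + R1 * fact (m + 1) + R2) * exp (norm x + \<sigma> * norm u)"
    using R1 R2 sigma_pos norm_triangle_ineq[of x "\<sigma> *\<^sub>R u"] by (intro mult_left_mono) auto
  finally show ?thesis by (simp add: exp_add)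
qed

lemma integrable_sample: "integrable std_gaussian (\<lambda>u. f (x + \<sigma> *\<^sub>R u))"
  by (rule integrable_std_gaussian_exp_growth) (use sample_exp_growth in \<open>auto simp: real_norm_def\<close>)

lemma integrable_sample_scaleR: "integrable std_gaussian (\<lambda>u. f (x + \<sigma> *\<^sub>R u) *\<^sub>R u)"
proof (rule integrable_std_gaussian_exp_growth)
  fix u :: 'a
  define K where "K = (\<bar>f 0\<bar> + R1 * fact (m + 1) + R2) * exp (norm x)"
  have "norm u \<le> exp (norm u)" using exp_ge_add_one_self[of "norm u"] by linarith
  moreover have "\<bar>f (x + \<sigma> *\<^sub>R u)\<bar> \<le> K * exp (\<sigma> * norm u)"
    unfolding K_def by (rule sample_exp_growth)
  moreover have "K \<ge> 0" using R1 R2 by (simp add: K_def)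
  ultimately have "\<bar>f (x + \<sigma> *\<^sub>R u)\<bar> * norm u \<le> K * exp (\<sigma> * norm u) * exp (norm u)"
    by (intro mult_mono) auto
  then show "norm (f (x + \<sigma> *\<^sub>R u) *\<^sub>R u)
      \<le> (\<bar>f 0\<bar> + R1 * fact (m + 1) + R2) * exp (norm x) * exp ((\<sigma> + 1) * norm u)"
    by (simp add: K_def algebra_simps exp_add)
qed measurable

lemma zo_dir_measurable [measurable]:
  "(\<lambda>(x, u). zo_dir x u) \<in> borel_measurable (borel \<Otimes>\<^sub>M borel)"
  unfolding zo_dir_def by measurable

text \<open>Subtracting \<open>f x\<close> changes nothing in the mean, as \<open>u\<close> is
  centred, but turns the sample into an increment that the Lipschitz bound controls.\<close>

lemma grad_fs: "grad fs x = (\<integral>u. zo_dir x u \<partial>std_gaussian)"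
proof -
  have "(\<integral>u. zo_dir x u \<partial>std_gaussian)
      = (\<integral>u. (1 / \<sigma>) *\<^sub>R (f (x + \<sigma> *\<^sub>R u) *\<^sub>R u) - (f x / \<sigma>) *\<^sub>R u \<partial>std_gaussian)"
    by (simp add: zo_dir_def diff_divide_distrib scaleR_left_diff_distrib)
  also have "\<dots> = (1 / \<sigma>) *\<^sub>R (\<integral>u. f (x + \<sigma> *\<^sub>R u) *\<^sub>R u \<partial>std_gaussian)"
    by (simp only: Bochner_Integration.integral_diff[OF integrable_scaleR_right[OF integrable_sample_scaleR]
          integrable_scaleR_right[OF integrable_std_gaussian_id]] integral_scaleR_right integral_std_gaussian_mean) simp
  finally show ?thesis using grad_eqI[OF GDERIV_fs_raw] by simp
qed

lemma norm_zo_dir_le: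
  "norm (zo_dir x u) \<le> 2 powr (real m - 1) * R1 * norm x ^ m * (norm u)\<^sup>2
     + 2 powr (real m - 1) * R1 * \<sigma> ^ m * norm u ^ (m + 2) + R2 * (norm u)\<^sup>2"
proof -
  define K where "K = 2 powr (real m - 1) * R1"
  have "\<bar>f (x + \<sigma> *\<^sub>R u) - f x\<bar> \<le> (K * (norm x ^ m + norm (\<sigma> *\<^sub>R u) ^ m) + R2) * norm (\<sigma> *\<^sub>R u)"
    unfolding K_def by (rule increment_le)
  then have "\<bar>f (x + \<sigma> *\<^sub>R u) - f x\<bar> / \<sigma> \<le> (K * (norm x ^ m + \<sigma> ^ m * norm u ^ m) + R2) * norm u"
    using sigma_pos by (simp add: field_simps power_mult_distrib)
  then have "\<bar>f (x + \<sigma> *\<^sub>R u) - f x\<bar> / \<sigma> * norm u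
      \<le> (K * (norm x ^ m + \<sigma> ^ m * norm u ^ m) + R2) * norm u * norm u"
    by (rule mult_right_mono) simp
  then show ?thesis
    unfolding K_def[symmetric] using sigma_pos
    by (simp add: zo_dir_def algebra_simps power2_eq_square power_add)
qed

lemma norm_zo_dir_power_le:
  assumes p: "p > 0"
  shows "norm (zo_dir x u) ^ p \<le> 3 ^ (p - 1) *
    (2 powr ((real m - 1) * p) * R1 ^ p * norm x ^ (m * p) * norm u ^ (2 * p)
     + 2 powr ((real m - 1) * p) * R1 ^ p * \<sigma> ^ (m * p) * norm u ^ ((m + 2) * p)
     + R2 ^ p * norm u ^ (2 * p))"
proof -
  define K where "K = 2 powr (real m - 1) * R1"
  have K: "K \<ge> 0" using R1 by (simp add: K_def)
  have Kp: "K ^ p = 2 powr ((real m - 1) * p) * R1 ^ p"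
    by (simp add: K_def power_mult_distrib powr_powr flip: powr_realpow)
  have "norm (zo_dir x u) ^ p \<le> (K * norm x ^ m * (norm u)\<^sup>2 + K * \<sigma> ^ m * norm u ^ (m + 2) + R2 * (norm u)\<^sup>2) ^ p"
    unfolding K_def by (intro power_mono norm_zo_dir_le) simp
  also have "\<dots> \<le> 3 ^ (p - 1) * ((K * norm x ^ m * (norm u)\<^sup>2) ^ p + (K * \<sigma> ^ m * norm u ^ (m + 2)) ^ p + (R2 * (norm u)\<^sup>2) ^ p)"
    using p K R2 sigma_pos by (intro power_add3_le) auto
  finally show ?thesis
    by (simp only: power_mult_distrib Kp power_mult[symmetric])
qed

lemma integrable_norm_zo_dir_power:
  assumes p: "p > 0"
  shows "integrable std_gaussian (\<lambda>u. norm (zo_dir x u) ^ p)"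
proof (rule Bochner_Integration.integrable_bound)
  show "integrable std_gaussian (\<lambda>u :: 'a. 3 ^ (p - 1) *
    (2 powr ((real m - 1) * p) * R1 ^ p * norm x ^ (m * p) * norm u ^ (2 * p)
     + 2 powr ((real m - 1) * p) * R1 ^ p * \<sigma> ^ (m * p) * norm u ^ ((m + 2) * p)
     + R2 ^ p * norm u ^ (2 * p)))"
    by (intro Bochner_Integration.integrable_add integrable_mult_right integrable_std_gaussian_norm_power)
  show "AE u in std_gaussian. norm (norm (zo_dir x u) ^ p) \<le> norm (3 ^ (p - 1) *
    (2 powr ((real m - 1) * p) * R1 ^ p * norm x ^ (m * p) * norm u ^ (2 * p)
     + 2 powr ((real m - 1) * p) * R1 ^ p * \<sigma> ^ (m * p) * norm u ^ ((m + 2) * p)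
     + R2 ^ p * norm u ^ (2 * p)))"
    using norm_zo_dir_power_le[OF p] by (intro AE_I2) (smt (verit) real_norm_def norm_ge_zero zero_le_power)
qed measurable

text \<open>The two entries of the maximum in \<open>H_const\<close> are the coefficient of
  \<open>norm x ^ (m * p)\<close> and the constant term; the Gaussian moments involved have orders
  2p and (m + 2)p.\<close>

lemma integral_norm_zo_dir_power_le:
  assumes p: "p > 0"
  shows "(\<integral>u. norm (zo_dir x u) ^ p \<partial>std_gaussian) \<le> H p * (norm x ^ (m * p) + 1)"
proof -
  define P where "P = 2 powr ((real m - 1) * p) * R1 ^ p"
  define s where "s = norm x ^ (m * p)"
  define M1 where "M1 = (2 * real p + real DIM('a)) ^ p"
  define M2 where "M2 = (real ((m + 2) * p) + real DIM('a)) powr (real ((m + 2) * p) / 2)"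
  have nn: "P \<ge> 0" "s \<ge> 0" using R1 by (simp_all add: P_def s_def)
  have M1: "(\<integral>u. norm u ^ (2 * p) \<partial>(std_gaussian :: 'a measure)) \<le> M1"
    using std_gaussian_norm_moment_le[of "2 * p", where 'a='a]
    by (simp add: M1_def powr_realpow add_nonneg_pos)
  have M2: "(\<integral>u. norm u ^ ((m + 2) * p) \<partial>(std_gaussian :: 'a measure)) \<le> M2"
    unfolding M2_def by (rule std_gaussian_norm_moment_le)
  note int = integrable_std_gaussian_norm_power[where 'a='a]
  have "(\<integral>u. norm (zo_dir x u) ^ p \<partial>std_gaussian)
      \<le> (\<integral>u. 3 ^ (p - 1) * (P * s * norm u ^ (2 * p) + P * \<sigma> ^ (m * p) * norm u ^ ((m + 2) * p)
            + R2 ^ p * norm u ^ (2 * p)) \<partial>(std_gaussian :: 'a measure))"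
    using norm_zo_dir_power_le[OF p]
    by (intro integral_mono Bochner_Integration.integrable_add integrable_mult_right int
        integrable_norm_zo_dir_power p) (auto simp: P_def s_def)
  also have "\<dots> = 3 ^ (p - 1) * (P * s * (\<integral>u. norm u ^ (2 * p) \<partial>(std_gaussian :: 'a measure))
      + P * \<sigma> ^ (m * p) * (\<integral>u. norm u ^ ((m + 2) * p) \<partial>(std_gaussian :: 'a measure))
      + R2 ^ p * (\<integral>u. norm u ^ (2 * p) \<partial>(std_gaussian :: 'a measure)))"
    using int[of "2 * p"] int[of "(m + 2) * p"] by simp
  also have "\<dots> \<le> 3 ^ (p - 1) * (P * s * M1 + P * \<sigma> ^ (m * p) * M2 + R2 ^ p * M1)"
    using nn R2 sigma_pos by (intro mult_left_mono add_mono M1 M2) auto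
  also have "\<dots> = 3 ^ (p - 1) * ((P * M1) * s + (R2 ^ p * M1 + P * \<sigma> ^ (m * p) * M2) * 1)"
    by (simp add: algebra_simps)
  also have "\<dots> \<le> 3 ^ (p - 1) * (max (P * M1) (R2 ^ p * M1 + P * \<sigma> ^ (m * p) * M2) * s
      + max (P * M1) (R2 ^ p * M1 + P * \<sigma> ^ (m * p) * M2) * 1)"
    using nn by (intro mult_left_mono add_mono mult_right_mono) auto
  also have "\<dots> = H p * (s + 1)"
    by (simp add: H_def H_const_def P_def M1_def M2_def algebra_simps)
  finally show ?thesis by (simp add: s_def)
qed

lemma H_nonneg: "p > 0 \<Longrightarrow> H p \<ge> 0"
  using R1 R2 sigma_pos by (auto simp: H_def H_const_def le_max_iff_disj)

lemma two_powr_twice: "2 powr (2 * real m - 2) = 2 powr (real m - 1) * 2 powr (real m - 1)"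
  by (simp flip: powr_add)

text \<open>Both gradients are integrals over the same \<open>u\<close>, so their difference reduces
  to increments of \<open>f\<close> by \<open>h\<close> at the points
  \<open>x + \<sigma> *\<^sub>R u\<close>.\<close>

lemma norm_grad_fs_diff_le:
  "norm (grad fs (x + h) - grad fs x) \<le> (A + B * norm x ^ m + C * norm h ^ m) * norm h"
proof -
  define d where "d = real DIM('a)"
  define P where "P = 2 powr (real m - 1)"
  define M where "M = (real m + 1 + d) powr ((real m + 1) / 2)"
  define a where "a = P * P * R1 * norm x ^ m + P * R1 * norm h ^ m + R2"
  define b where "b = P * P * R1 * \<sigma> ^ m"
  have P: "P \<ge> 0" by (simp add: P_def)
  have ab: "a \<ge> 0" "b \<ge> 0" using R1 R2 sigma_pos by (simp_all add: a_def b_def P_def)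
  note int = integrable_std_gaussian_norm_power[where 'a='a]
  have pt: "norm ((f (x + h + \<sigma> *\<^sub>R u) - f (x + \<sigma> *\<^sub>R u)) *\<^sub>R u)
      \<le> norm h * (a * norm u ^ 1 + b * norm u ^ (m + 1))" for u
  proof -
    have "norm (x + \<sigma> *\<^sub>R u) \<le> norm x + \<sigma> * norm u"
      using norm_triangle_ineq[of x "\<sigma> *\<^sub>R u"] sigma_pos by simp
    moreover have "norm (x + h + \<sigma> *\<^sub>R u) \<le> norm (x + \<sigma> *\<^sub>R u) + norm h"
      using norm_triangle_ineq[of "x + \<sigma> *\<^sub>R u" h] by (simp add: algebra_simps)
    ultimately have "\<bar>f (x + h + \<sigma> *\<^sub>R u) - f (x + \<sigma> *\<^sub>R u)\<bar>
        \<le> (R1 * (norm x + \<sigma> * norm u + norm h) ^ m + R2) * norm (x + h + \<sigma> *\<^sub>R u - (x + \<sigma> *\<^sub>R u))"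
      using norm_ge_zero[of h] by (intro lip) linarith+
    also have "\<dots> = (R1 * (norm x + \<sigma> * norm u + norm h) ^ m + R2) * norm h" by simp
    \<comment> \<open>The radius is split first into \<open>h\<close> and the rest, then the rest
      into \<open>x\<close> and the noise. Hence \<open>h\<close> carries one factor
      \<open>P\<close> (constant \<open>C\<close>), \<open>x\<close> and the noise two (constants
      \<open>B\<close> and \<open>A\<close>).\<close>
    also have "\<dots> \<le> (R1 * (P * (P * (norm x ^ m + (\<sigma> * norm u) ^ m) + norm h ^ m)) + R2) * norm h"
    proof (intro mult_right_mono add_right_mono mult_left_mono R1)
      have "(norm x + \<sigma> * norm u + norm h) ^ m \<le> P * ((norm x + \<sigma> * norm u) ^ m + norm h ^ m)"
        unfolding P_def using sigma_pos by (intro power_add_le) auto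
      also have "\<dots> \<le> P * (P * (norm x ^ m + (\<sigma> * norm u) ^ m) + norm h ^ m)"
        unfolding P_def using sigma_pos by (intro mult_left_mono add_right_mono power_add_le) auto
      finally show "(norm x + \<sigma> * norm u + norm h) ^ m
        \<le> P * (P * (norm x ^ m + (\<sigma> * norm u) ^ m) + norm h ^ m)" .
    qed simp
    also have "\<dots> = norm h * (a + b * norm u ^ m)"
      by (simp add: a_def b_def algebra_simps power_mult_distrib)
    finally have "\<bar>f (x + h + \<sigma> *\<^sub>R u) - f (x + \<sigma> *\<^sub>R u)\<bar> * norm u
        \<le> norm h * (a + b * norm u ^ m) * norm u"
      by (rule mult_right_mono) simp
    then show ?thesis unfolding norm_scaleR by (simp add: algebra_simps)
  qed
  have "grad fs (x + h) - grad fs x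
      = (1 / \<sigma>) *\<^sub>R (\<integral>u. (f (x + h + \<sigma> *\<^sub>R u) - f (x + \<sigma> *\<^sub>R u)) *\<^sub>R u \<partial>std_gaussian)"
    using integrable_sample_scaleR[of "x + h"] integrable_sample_scaleR[of x]
    by (simp add: grad_eqI[OF GDERIV_fs_raw] scaleR_left_diff_distrib scaleR_right_diff_distrib)
  then have "norm (grad fs (x + h) - grad fs x)
      = norm (\<integral>u. (f (x + h + \<sigma> *\<^sub>R u) - f (x + \<sigma> *\<^sub>R u)) *\<^sub>R u \<partial>std_gaussian) / \<sigma>"
    using sigma_pos by simp
  also have "\<dots> \<le> (\<integral>u. norm h * (a * norm u ^ 1 + b * norm u ^ (m + 1)) \<partial>(std_gaussian :: 'a measure)) / \<sigma>"
  proof (intro divide_right_mono Bochner_Integration.integral_norm_bound_integral pt)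
    show "integrable std_gaussian (\<lambda>u. (f (x + h + \<sigma> *\<^sub>R u) - f (x + \<sigma> *\<^sub>R u)) *\<^sub>R u)"
      using integrable_sample_scaleR[of "x + h"] integrable_sample_scaleR[of x]
      by (simp add: scaleR_left_diff_distrib)
    show "integrable std_gaussian (\<lambda>u :: 'a. norm h * (a * norm u ^ 1 + b * norm u ^ (m + 1)))"
      by (intro Bochner_Integration.integrable_add integrable_mult_right int)
  qed (use sigma_pos in simp)
  also have "\<dots> = norm h * (a * (\<integral>u. norm u \<partial>(std_gaussian :: 'a measure))
      + b * (\<integral>u. norm u ^ (m + 1) \<partial>(std_gaussian :: 'a measure))) / \<sigma>"
    using int[of 1] int[of "m + 1"] by simp
  also have "\<dots> \<le> norm h * (a * sqrt d + b * M) / \<sigma>"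
    using std_gaussian_norm_le[where 'a='a] std_gaussian_norm_moment_le[of "m + 1", where 'a='a] ab sigma_pos
    by (intro divide_right_mono mult_left_mono add_mono) (auto simp: d_def M_def add_ac)
  also have "\<dots> = (A + B * norm x ^ m + C * norm h ^ m) * norm h"
  proof -
    have "\<sigma> powr (real m - 1) = \<sigma> ^ m / \<sigma>" using sigma_pos by (simp add: powr_diff powr_realpow)
    then show ?thesis
      unfolding A_def B_def C_def two_powr_twice P_def[symmetric] d_def[symmetric] M_def[symmetric] a_def b_def
      using sigma_pos by (simp add: field_simps)
  qed
  finally show ?thesis .
qed

lemma isCont_fs: "isCont fs x"
  using GDERIV_fs[of x] unfolding gderiv_def by (rule has_derivative_continuous)

lemma isCont_grad_fs: "isCont (grad fs) x"
proof (rule isCont_of_norm_diff_le[of 1])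
  fix y assume y: "norm (y - x) < 1"
  have "norm (grad fs y - grad fs x) \<le> (A + B * norm x ^ m + C * norm (y - x) ^ m) * norm (y - x)"
    using norm_grad_fs_diff_le[of x "y - x"] by simp
  also have "\<dots> \<le> (A + B * norm x ^ m + C * 1) * norm (y - x)"
    using y C_nonneg by (intro mult_right_mono add_left_mono mult_left_mono power_le_one) auto
  finally show "norm (grad fs y - grad fs x) \<le> (A + B * norm x ^ m + C * 1) * norm (y - x)" .
qed simp

lemma borel_measurable_fs [measurable]: "fs \<in> borel_measurable borel"
  by (intro borel_measurable_continuous_onI) (simp add: continuous_at_imp_continuous_on isCont_fs)

lemma borel_measurable_grad_fs [measurable]: "grad fs \<in> borel_measurable borel"
  by (intro borel_measurable_continuous_onI) (simp add: continuous_at_imp_continuous_on isCont_grad_fs)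

text \<open>The integration along the segment is a monotonicity argument: \<open>g\<close> is
  \<open>fs\<close> on the segment minus the claimed model, and the gradient estimate makes its
  derivative nonpositive. The primitives of t and t^(m+1) produce 1/2 and 1/(m+2).\<close>

lemma fs_descent:
  "fs (x + h) \<le> fs x + grad fs x \<bullet> h + (A + B * norm x ^ m) / 2 * (norm h)\<^sup>2
     + C / (real m + 2) * norm h ^ (m + 2)"
proof -
  define a where "a = A + B * norm x ^ m"
  define g where "g t = fs (x + t *\<^sub>R h) - t * (grad fs x \<bullet> h) - a * (norm h)\<^sup>2 / 2 * t\<^sup>2
      - C * norm h ^ (m + 2) / (real m + 2) * t ^ (m + 2)" for t
  have "g 1 \<le> g 0"
  proof (rule DERIV_nonpos_imp_nonincreasing[where a=0 and b=1 and f=g])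
    fix t :: real assume t: "0 \<le> t" "t \<le> 1"
    define D where "D = (grad fs (x + t *\<^sub>R h) - grad fs x) \<bullet> h - a * (norm h)\<^sup>2 * t
      - C * norm h ^ (m + 2) * t ^ (m + 1)"
    have "(fs has_derivative (\<lambda>k. k \<bullet> grad fs (x + t *\<^sub>R h))) (at (x + t *\<^sub>R h))"
      using GDERIV_fs unfolding gderiv_def .
    moreover have "((\<lambda>t. x + t *\<^sub>R h) has_derivative (\<lambda>s. s *\<^sub>R h)) (at t)"
      by (auto intro!: derivative_eq_intros)
    ultimately have "((\<lambda>t. fs (x + t *\<^sub>R h)) has_derivative (\<lambda>s. (s *\<^sub>R h) \<bullet> grad fs (x + t *\<^sub>R h))) (at t)"
      by (rule has_derivative_compose[rotated])
    then have fs': "((\<lambda>t. fs (x + t *\<^sub>R h)) has_real_derivative (grad fs (x + t *\<^sub>R h) \<bullet> h)) (at t)"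
      by (rule has_derivative_imp_has_field_derivative) (simp add: inner_commute)
    have "(g has_real_derivative D) (at t)"
      unfolding g_def D_def
      apply (rule derivative_eq_intros fs' refl | simp)+
      apply (simp add: field_simps inner_diff_left)
      done
    moreover have "D \<le> 0"
    proof -
      have "(grad fs (x + t *\<^sub>R h) - grad fs x) \<bullet> h \<le> norm (grad fs (x + t *\<^sub>R h) - grad fs x) * norm h"
        by (rule norm_cauchy_schwarz)
      also have "\<dots> \<le> (a + C * norm (t *\<^sub>R h) ^ m) * norm (t *\<^sub>R h) * norm h"
        unfolding a_def by (intro mult_right_mono norm_grad_fs_diff_le) auto
      also have "\<dots> = a * (norm h)\<^sup>2 * t + C * norm h ^ (m + 2) * t ^ (m + 1)"
        using t by (simp add: algebra_simps power_mult_distrib power2_eq_square)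
      finally show ?thesis by (simp add: D_def)
    qed
    ultimately show "\<exists>y. (g has_real_derivative y) (at t) \<and> y \<le> 0" by blast
  qed simp
  then show ?thesis by (simp add: g_def a_def field_simps)
qed

lemma fs_le: "fs x \<le> f x + \<sigma> * ((2 powr (real m - 1) * R1 * norm x ^ m + R2) * sqrt (real DIM('a))
    + 2 powr (real m - 1) * R1 * \<sigma> ^ m * (real m + 1 + real DIM('a)) powr ((real m + 1) / 2))"
proof -
  define K where "K = 2 powr (real m - 1) * R1"
  have K: "K \<ge> 0" using R1 by (simp add: K_def)
  note int = integrable_std_gaussian_norm_power[where 'a='a]
  have "fs x \<le> (\<integral>u. f x + \<sigma> * ((K * norm x ^ m + R2) * norm u ^ 1 + K * \<sigma> ^ m * norm u ^ (m + 1)) \<partial>(std_gaussian :: 'a measure))"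
    unfolding gauss_smooth_def
  proof (rule integral_mono)
    show "integrable std_gaussian (\<lambda>u :: 'a. f x + \<sigma> * ((K * norm x ^ m + R2) * norm u ^ 1 + K * \<sigma> ^ m * norm u ^ (m + 1)))"
      by (intro Bochner_Integration.integrable_add integrable_mult_right int) simp
    fix u :: 'a
    have "f (x + \<sigma> *\<^sub>R u) - f x \<le> (K * (norm x ^ m + norm (\<sigma> *\<^sub>R u) ^ m) + R2) * norm (\<sigma> *\<^sub>R u)"
      unfolding K_def using increment_le by (rule order_trans[OF abs_ge_self])
    then show "f (x + \<sigma> *\<^sub>R u) \<le> f x + \<sigma> * ((K * norm x ^ m + R2) * norm u ^ 1 + K * \<sigma> ^ m * norm u ^ (m + 1))"
      using sigma_pos by (simp add: algebra_simps power_mult_distrib)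
  qed (rule integrable_sample)
  also have "\<dots> = f x + \<sigma> * ((K * norm x ^ m + R2) * (\<integral>u. norm u \<partial>(std_gaussian :: 'a measure))
      + K * \<sigma> ^ m * (\<integral>u. norm u ^ (m + 1) \<partial>(std_gaussian :: 'a measure)))"
    using int[of 1] int[of "m + 1"] std_gaussian.prob_space[where 'a='a] by simp
  also have "\<dots> \<le> f x + \<sigma> * ((K * norm x ^ m + R2) * sqrt (real DIM('a))
      + K * \<sigma> ^ m * (real m + 1 + real DIM('a)) powr ((real m + 1) / 2))"
    using std_gaussian_norm_le[where 'a='a] std_gaussian_norm_moment_le[of "m + 1", where 'a='a] K R2 sigma_pos
    by (intro add_left_mono mult_left_mono add_mono) (auto simp: add_ac)
  finally show ?thesis by (simp add: K_def)
qed

lemma fs_ge: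
  assumes "\<And>y. c \<le> f y"
  shows "c \<le> fs x"
proof -
  have "(\<integral>u. c \<partial>(std_gaussian :: 'a measure)) \<le> fs x"
    unfolding gauss_smooth_def by (intro integral_mono integrable_sample assms) simp
  then show ?thesis using std_gaussian.prob_space[where 'a='a] by simp
qed

section \<open>One step from a fixed point, averaged over the sample\<close>

definition step_error :: "real \<Rightarrow> real" where
  "step_error t = H 2 * t\<^sup>2 * (A + B) / 2 + C / (real m + 2) * H (m + 2) * t ^ (m + 2)"

definition scaled_grad :: "'a \<Rightarrow> real" where
  "scaled_grad x = (norm (grad fs x))\<^sup>2 / (norm x ^ m + 1)\<^sup>2"

text \<open>A deterministic map of iterate and sample, so that the sample can be averaged with the
  iterate frozen.\<close>

definition zo_step :: "real \<Rightarrow> 'a \<Rightarrow> 'a \<Rightarrow> 'a" where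
  "zo_step t x u = x - (t / (norm x ^ (2 * m) + 1)) *\<^sub>R zo_dir x u"

lemma step_error_nonneg: "t \<ge> 0 \<Longrightarrow> step_error t \<ge> 0"
  using A_nonneg B_nonneg C_nonneg H_nonneg by (simp add: step_error_def)

lemma scaled_grad_nonneg: "scaled_grad x \<ge> 0"
  by (simp add: scaled_grad_def)

lemma scaled_grad_measurable [measurable]: "scaled_grad \<in> borel_measurable borel"
  unfolding scaled_grad_def by measurable

lemma zo_step_measurable [measurable]:
  "(\<lambda>(x, u). zo_step t x u) \<in> borel_measurable (borel \<Otimes>\<^sub>M borel)"
  unfolding zo_step_def by measurable

lemma integrable_zo_dir: "integrable std_gaussian (zo_dir x)"
proof (rule Bochner_Integration.integrable_bound)
  show "integrable std_gaussian (\<lambda>u. norm (zo_dir x u) ^ 1)"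
    by (rule integrable_norm_zo_dir_power) simp
  show "zo_dir x \<in> borel_measurable std_gaussian"
    unfolding zo_dir_def[abs_def] by measurable
qed (rule AE_I2, simp)

lemma
  assumes lower: "\<And>y. c \<le> f y" and t: "t \<ge> 0"
  shows integrable_fs_zo_step: "integrable std_gaussian (\<lambda>u. fs (zo_step t x u))"
    and integral_fs_zo_step_le: "(\<integral>u. fs (zo_step t x u) \<partial>std_gaussian)
      \<le> fs x - t * scaled_grad x + step_error t"
proof -
  define s where "s = norm x ^ m"
  define r where "r = t / (s\<^sup>2 + 1)"
  have s: "s \<ge> 0" and s2: "norm x ^ (2 * m) = s\<^sup>2"
    by (simp_all add: s_def power_even_eq)
  have r: "r \<ge> 0" using t by (simp add: r_def add_nonneg_nonneg)
  have s21: "s\<^sup>2 + 1 > 0" by (simp add: add_nonneg_pos)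
  define F where "F u = fs x - r * (grad fs x \<bullet> zo_dir x u)
      + (A + B * s) / 2 * r\<^sup>2 * norm (zo_dir x u) ^ 2
      + C / (real m + 2) * r ^ (m + 2) * norm (zo_dir x u) ^ (m + 2)" for u
  have step: "zo_step t x u = x + (- r *\<^sub>R zo_dir x u)" for u
    by (simp add: zo_step_def r_def s2)
  have le_F: "fs (zo_step t x u) \<le> F u" for u
  proof -
    have n: "norm (- r *\<^sub>R zo_dir x u) = r * norm (zo_dir x u)" using r by simp
    have i: "grad fs x \<bullet> (- r *\<^sub>R zo_dir x u) = - (r * (grad fs x \<bullet> zo_dir x u))" by simp
    show ?thesis
      using fs_descent[of x "- r *\<^sub>R zo_dir x u"]
      unfolding step F_def n i s_def[symmetric] power_mult_distrib mult.assoc by linarith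
  qed
  have moment: "(\<integral>u. norm (zo_dir x u) ^ p \<partial>std_gaussian) \<le> H p * (s ^ p + 1)" if "p > 0" for p
    using integral_norm_zo_dir_power_le[OF that, of x] by (simp add: s_def power_mult)
  have int2: "integrable std_gaussian (\<lambda>u. norm (zo_dir x u) ^ 2)"
    and intm: "integrable std_gaussian (\<lambda>u. norm (zo_dir x u) ^ (m + 2))"
    by (intro integrable_norm_zo_dir_power; simp)+
  have int_inner: "integrable std_gaussian (\<lambda>u. grad fs x \<bullet> zo_dir x u)"
    by (intro integrable_inner_right integrable_zo_dir)
  have int_F: "integrable std_gaussian F"
    unfolding F_def by (intro Bochner_Integration.integrable_add Bochner_Integration.integrable_diff
        integrable_mult_right int2 intm int_inner) simp
  \<comment> \<open>The composition is squeezed between the lower bound \<open>c\<close> and the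
    integrable \<open>F\<close>.\<close>
  show int: "integrable std_gaussian (\<lambda>u. fs (zo_step t x u))"
  proof (rule Bochner_Integration.integrable_bound)
    show "integrable std_gaussian (\<lambda>u. \<bar>F u\<bar> + \<bar>c\<bar>)" using int_F by simp
    show "AE u in std_gaussian. norm (fs (zo_step t x u)) \<le> norm (\<bar>F u\<bar> + \<bar>c\<bar>)"
    proof (rule AE_I2)
      fix u show "norm (fs (zo_step t x u)) \<le> norm (\<bar>F u\<bar> + \<bar>c\<bar>)"
        using le_F[of u] fs_ge[OF lower, of "zo_step t x u"]
        unfolding real_norm_def by linarith
    qed
  qed measurable
  have "(\<integral>u. fs (zo_step t x u) \<partial>std_gaussian) \<le> (\<integral>u. F u \<partial>std_gaussian)"
    by (intro integral_mono int int_F le_F)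
  also have "\<dots> = fs x - r * (norm (grad fs x))\<^sup>2
      + (A + B * s) / 2 * r\<^sup>2 * (\<integral>u. norm (zo_dir x u) ^ 2 \<partial>std_gaussian)
      + C / (real m + 2) * r ^ (m + 2) * (\<integral>u. norm (zo_dir x u) ^ (m + 2) \<partial>std_gaussian)"
  proof -
    have "(\<integral>u. grad fs x \<bullet> zo_dir x u \<partial>std_gaussian) = (norm (grad fs x))\<^sup>2"
      using integrable_zo_dir by (simp add: power2_norm_eq_inner flip: grad_fs)
    then show ?thesis
      unfolding F_def using int2 intm int_inner std_gaussian.prob_space[where 'a='a] by simp
  qed
  also have "\<dots> \<le> fs x - t * scaled_grad x + H 2 * t\<^sup>2 * (A + B) / 2
      + C / (real m + 2) * H (m + 2) * t ^ (m + 2)"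
  proof (intro add_mono diff_left_mono)
    \<comment> \<open>Passes from the weight of the actual step to the smaller weight in
      \<open>scaled_grad\<close>.\<close>
    have "s\<^sup>2 + 1 \<le> (s + 1)\<^sup>2" using s by (simp add: power2_sum)
    then have "scaled_grad x \<le> (norm (grad fs x))\<^sup>2 / (s\<^sup>2 + 1)"
      unfolding scaled_grad_def s_def[symmetric] using s s21
      by (intro divide_left_mono mult_pos_pos) auto
    from mult_left_mono[OF this t]
    show "t * scaled_grad x \<le> r * (norm (grad fs x))\<^sup>2"
      by (simp add: r_def)
    have "(A + B * s) / 2 * r\<^sup>2 * (\<integral>u. norm (zo_dir x u) ^ 2 \<partial>std_gaussian)
        \<le> (A + B * s) / 2 * r\<^sup>2 * (H 2 * (s\<^sup>2 + 1))"
      using A_nonneg B_nonneg s by (intro mult_left_mono moment) auto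
    also have "\<dots> = H 2 / 2 * (A + B * s) * (r\<^sup>2 * (s\<^sup>2 + 1))" by simp
    \<comment> \<open>The moment bound consumes one of the two normalising factors; the other one
      absorbs the linear growth of \<open>A + B * s\<close>, because s <= s^2 + 1.\<close>
    also have "r\<^sup>2 * (s\<^sup>2 + 1) = t\<^sup>2 / (s\<^sup>2 + 1)"
      using s21 by (simp add: r_def power_divide power2_eq_square[of "s\<^sup>2 + 1"])
    also have "H 2 / 2 * (A + B * s) * (t\<^sup>2 / (s\<^sup>2 + 1)) = H 2 * t\<^sup>2 / 2 * ((A + B * s) / (s\<^sup>2 + 1))"
      by simp
    also have "\<dots> \<le> H 2 * t\<^sup>2 / 2 * (A + B)"
    proof (rule mult_left_mono)
      have "A * 1 + B * s \<le> A * (s\<^sup>2 + 1) + B * (s\<^sup>2 + 1)"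
      proof (rule add_mono; rule mult_left_mono)
        have "2 * s \<le> s\<^sup>2 + 1" using zero_le_power2[of "s - 1"] by (simp add: power2_diff)
        then show "s \<le> s\<^sup>2 + 1" using s by linarith
      qed (auto simp: A_nonneg B_nonneg)
      then have "A + B * s \<le> (A + B) * (s\<^sup>2 + 1)" by (simp add: distrib_right)
      then show "(A + B * s) / (s\<^sup>2 + 1) \<le> A + B" using s21 by (simp add: pos_divide_le_eq)
    qed (use H_nonneg[of 2] in simp)
    finally show "(A + B * s) / 2 * r\<^sup>2 * (\<integral>u. norm (zo_dir x u) ^ 2 \<partial>std_gaussian)
        \<le> H 2 * t\<^sup>2 * (A + B) / 2" by simp
    define K where "K = C / (real m + 2)"
    have K: "K \<ge> 0" using C_nonneg by (simp add: K_def)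
    have "K * r ^ (m + 2) * (\<integral>u. norm (zo_dir x u) ^ (m + 2) \<partial>std_gaussian)
        \<le> K * r ^ (m + 2) * (H (m + 2) * (s ^ (m + 2) + 1))"
      using K r by (intro mult_left_mono moment mult_nonneg_nonneg zero_le_power) auto
    also have "\<dots> = K * H (m + 2) * (t ^ (m + 2) * ((s ^ (m + 2) + 1) / (s\<^sup>2 + 1) ^ (m + 2)))"
      unfolding r_def power_divide by simp
    also have "\<dots> \<le> K * H (m + 2) * (t ^ (m + 2) * 1)"
    proof (rule mult_left_mono; (rule mult_left_mono)?)
      show "(s ^ (m + 2) + 1) / (s\<^sup>2 + 1) ^ (m + 2) \<le> 1"
        using power_plus_one_le_power[OF s, of m] zero_less_power[OF s21] by (simp only: divide_le_eq_1_pos)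
      show "0 \<le> K * H (m + 2)" using K H_nonneg[of "m + 2"] by simp
    qed (use t in simp)
    finally show "C / (real m + 2) * r ^ (m + 2) * (\<integral>u. norm (zo_dir x u) ^ (m + 2) \<partial>std_gaussian)
        \<le> C / (real m + 2) * H (m + 2) * t ^ (m + 2)" unfolding K_def mult_1_right .
  qed
  finally show "(\<integral>u. fs (zo_step t x u) \<partial>std_gaussian) \<le> fs x - t * scaled_grad x + step_error t"
    by (simp add: step_error_def)
qed

end

section \<open>The random iteration\<close>

text \<open>Freezing: the joint law of independent variables is a product, so Tonelli integrates the
  second one out first.\<close>

lemma (in prob_space) nn_integral_indep_var:
  assumes indep: "indep_var S X T Y" and [measurable]: "h \<in> borel_measurable (S \<Otimes>\<^sub>M T)"
  shows "(\<integral>\<^sup>+\<omega>. h (X \<omega>, Y \<omega>) \<partial>M) = (\<integral>\<^sup>+\<omega>. (\<integral>\<^sup>+y. h (X \<omega>, y) \<partial>distr M T Y) \<partial>M)"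
proof -
  have [measurable]: "X \<in> measurable M S" "Y \<in> measurable M T"
    using indep by (auto simp: indep_var_distribution_eq)
  interpret Y: prob_space "distr M T Y" by (rule prob_space_distr) measurable
  have "(\<integral>\<^sup>+\<omega>. h (X \<omega>, Y \<omega>) \<partial>M) = (\<integral>\<^sup>+z. h z \<partial>distr M (S \<Otimes>\<^sub>M T) (\<lambda>\<omega>. (X \<omega>, Y \<omega>)))"
    by (subst nn_integral_distr) auto
  also have "distr M (S \<Otimes>\<^sub>M T) (\<lambda>\<omega>. (X \<omega>, Y \<omega>)) = distr M S X \<Otimes>\<^sub>M distr M T Y"
    using indep by (simp add: indep_var_distribution_eq)
  also have "(\<integral>\<^sup>+z. h z \<partial>(distr M S X \<Otimes>\<^sub>M distr M T Y))
      = (\<integral>\<^sup>+x. (\<integral>\<^sup>+y. h (x, y) \<partial>distr M T Y) \<partial>distr M S X)"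
    by (rule Y.nn_integral_fst[symmetric]) measurable
  also have "\<dots> = (\<integral>\<^sup>+\<omega>. (\<integral>\<^sup>+y. h (X \<omega>, y) \<partial>distr M T Y) \<partial>M)"
    by (rule nn_integral_distr) measurable
  finally show ?thesis .
qed

lemma zo_iter_cong:
  assumes "\<And>i. i < k \<Longrightarrow> u i \<omega> = u' i \<omega>'"
  shows "zo_iter f \<sigma> \<tau> m x0 u k \<omega> = zo_iter f \<sigma> \<tau> m x0 u' k \<omega>'"
  using assms
proof (induction k)
  case (Suc k)
  then have "zo_iter f \<sigma> \<tau> m x0 u k \<omega> = zo_iter f \<sigma> \<tau> m x0 u' k \<omega>'" "u k \<omega> = u' k \<omega>'"
    by simp_all
  then show ?case by simp
qed simp

text \<open>Stated for arbitrary driving functions on an arbitrary space, so that it applies to the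
  coordinate process on a finite product.\<close>

lemma zo_iter_measurable:
  fixes f :: "'a::euclidean_space \<Rightarrow> real"
  assumes [measurable]: "f \<in> borel_measurable borel"
    and "\<And>i. i < k \<Longrightarrow> u i \<in> borel_measurable N"
  shows "zo_iter f \<sigma> \<tau> m x0 u k \<in> borel_measurable N"
  using assms(2)
proof (induction k)
  case 0
  have "zo_iter f \<sigma> \<tau> m x0 u 0 = (\<lambda>_. x0)" by (rule ext) simp
  then show ?case by simp
next
  case (Suc k)
  define Z where "Z = zo_iter f \<sigma> \<tau> m x0 u k"
  have [measurable]: "Z \<in> borel_measurable N" "u k \<in> borel_measurable N"
    using Suc by (auto simp: Z_def)
  have "zo_iter f \<sigma> \<tau> m x0 u (Suc k) = (\<lambda>\<omega>. Z \<omega> - (\<tau> k / (norm (Z \<omega>) ^ (2 * m) + 1)) *\<^sub>R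
      (((f (Z \<omega> + \<sigma> *\<^sub>R u k \<omega>) - f (Z \<omega>)) / \<sigma>) *\<^sub>R u k \<omega>))"
    by (rule ext) (simp add: Let_def Z_def)
  moreover have "\<dots> \<in> borel_measurable N" by measurable
  ultimately show ?case by simp
qed

lemma (in prob_space) indep_var_zo_iter:
  fixes f :: "'b::euclidean_space \<Rightarrow> real"
  assumes f: "f \<in> borel_measurable borel" and indep: "indep_vars (\<lambda>_. borel) u UNIV"
  shows "indep_var borel (zo_iter f \<sigma> \<tau> m x0 u k) borel (u k)"
proof -
  \<comment> \<open>The iteration run on coordinates is a measurable function of the first
    \<open>k\<close> samples alone. Disjoint index blocks are independent, and composing with
    \<open>?Y\<close> transfers this to the iterate.\<close>
  let ?Y = "zo_iter f \<sigma> \<tau> m x0 (\<lambda>i w. w i) k"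
  have "indep_var (PiM {..<k} (\<lambda>_. borel)) (\<lambda>\<omega>. \<lambda>i\<in>{..<k}. u i \<omega>)
      (PiM {k} (\<lambda>_. borel)) (\<lambda>\<omega>. \<lambda>i\<in>{k}. u i \<omega>)"
    by (rule indep_var_restrict[OF indep]) auto
  moreover have "?Y \<in> borel_measurable (PiM {..<k} (\<lambda>_. borel))"
    by (rule zo_iter_measurable[OF f]) (auto intro: measurable_component_singleton)
  moreover have "(\<lambda>w. w k) \<in> borel_measurable (PiM {k} (\<lambda>_. borel))"
    by (rule measurable_component_singleton) simp
  ultimately have "indep_var borel (?Y \<circ> (\<lambda>\<omega>. \<lambda>i\<in>{..<k}. u i \<omega>)) borel ((\<lambda>w. w k) \<circ> (\<lambda>\<omega>. \<lambda>i\<in>{k}. u i \<omega>))"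
    by (rule indep_var_compose)
  moreover have "?Y \<circ> (\<lambda>\<omega>. \<lambda>i\<in>{..<k}. u i \<omega>) = zo_iter f \<sigma> \<tau> m x0 u k"
    by (auto simp: fun_eq_iff intro: zo_iter_cong)
  ultimately show ?thesis by (simp add: comp_def)
qed

section \<open>The process and its expectations\<close>

locale zo_process = poly_lipschitz f R1 R2 \<sigma> m + prob_space M
  for f :: "'a::euclidean_space \<Rightarrow> real" and R1 R2 \<sigma> :: real and m :: nat and M :: "'w measure" +
  fixes u :: "nat \<Rightarrow> 'w \<Rightarrow> 'a" and x0 :: 'a and \<tau> :: "nat \<Rightarrow> real" and c :: real
  assumes lower: "\<And>y. c \<le> f y" and tau_pos: "\<And>k. 0 < \<tau> k"
    and indep: "indep_vars (\<lambda>_. borel) u UNIV"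
    and gauss: "\<And>k. distr M lborel (u k) = std_gaussian"
begin

abbreviation X :: "nat \<Rightarrow> 'w \<Rightarrow> 'a" where "X \<equiv> zo_iter f \<sigma> \<tau> m x0 u"

lemma X_measurable [measurable]: "X k \<in> borel_measurable M"
  using indep_var_rv1[OF indep_var_zo_iter[OF borel_measurable_f indep]] .

lemma X_Suc: "X (Suc k) \<omega> = zo_step (\<tau> k) (X k \<omega>) (u k \<omega>)"
  by (simp add: Let_def zo_step_def zo_dir_def)

text \<open>Since \<open>fs - c\<close> is nonnegative, working with nonnegative integrals gives the integrability of
  \<open>fs (X k)\<close> by induction, without any moment bound on \<open>X k\<close>.\<close>

lemma nn_integral_step_le:
  "(\<integral>\<^sup>+\<omega>. ennreal (fs (X (Suc k) \<omega>) - c) \<partial>M) + (\<integral>\<^sup>+\<omega>. ennreal (\<tau> k * scaled_grad (X k \<omega>)) \<partial>M)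
    \<le> (\<integral>\<^sup>+\<omega>. ennreal (fs (X k \<omega>) - c) \<partial>M) + ennreal (step_error (\<tau> k))"
proof -
  have tau: "\<tau> k \<ge> 0" using tau_pos[of k] by simp
  have dist: "distr M borel (u k) = std_gaussian"
    using gauss[of k] by (simp cong: distr_cong)
  \<comment> \<open>The one-step estimate at a frozen iterate, with the gradient term moved to the
    left so that both sides are sums of nonnegative terms.\<close>
  have step: "(\<integral>\<^sup>+y. ennreal (fs (zo_step (\<tau> k) x y) - c) \<partial>std_gaussian) + ennreal (\<tau> k * scaled_grad x)
      \<le> ennreal (fs x - c) + ennreal (step_error (\<tau> k))" for x
  proof -
    note int = integrable_fs_zo_step[OF lower tau, of x]
    have "(\<integral>\<^sup>+y. ennreal (fs (zo_step (\<tau> k) x y) - c) \<partial>std_gaussian)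
        = ennreal (\<integral>y. fs (zo_step (\<tau> k) x y) - c \<partial>std_gaussian)"
      using int fs_ge[OF lower] by (intro nn_integral_eq_integral) auto
    also have "(\<integral>y. fs (zo_step (\<tau> k) x y) - c \<partial>std_gaussian)
        = (\<integral>y. fs (zo_step (\<tau> k) x y) \<partial>std_gaussian) - c"
      using int std_gaussian.prob_space[where 'a='a] by simp
    finally have eq: "(\<integral>\<^sup>+y. ennreal (fs (zo_step (\<tau> k) x y) - c) \<partial>std_gaussian)
        = ennreal ((\<integral>y. fs (zo_step (\<tau> k) x y) \<partial>std_gaussian) - c)" .
    have "c \<le> (\<integral>y. fs (zo_step (\<tau> k) x y) \<partial>std_gaussian)"
      using int fs_ge[OF lower] std_gaussian.prob_space[where 'a='a]
        integral_mono[of std_gaussian "\<lambda>_. c" "\<lambda>y. fs (zo_step (\<tau> k) x y)"] by simp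
    then show ?thesis
      unfolding eq using integral_fs_zo_step_le[OF lower tau, of x] fs_ge[OF lower, of x] tau
      by (simp add: scaled_grad_nonneg step_error_nonneg flip: ennreal_plus)
  qed
  have "(\<integral>\<^sup>+\<omega>. ennreal (fs (X (Suc k) \<omega>) - c) \<partial>M)
      = (\<integral>\<^sup>+\<omega>. (case (X k \<omega>, u k \<omega>) of (x, y) \<Rightarrow> ennreal (fs (zo_step (\<tau> k) x y) - c)) \<partial>M)"
    unfolding X_Suc by simp
  also have "\<dots> = (\<integral>\<^sup>+\<omega>. (\<integral>\<^sup>+y. ennreal (fs (zo_step (\<tau> k) (X k \<omega>) y) - c) \<partial>std_gaussian) \<partial>M)"
    by (subst nn_integral_indep_var[OF indep_var_zo_iter[OF borel_measurable_f indep]]) (auto simp: dist)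
  finally have "(\<integral>\<^sup>+\<omega>. ennreal (fs (X (Suc k) \<omega>) - c) \<partial>M) + (\<integral>\<^sup>+\<omega>. ennreal (\<tau> k * scaled_grad (X k \<omega>)) \<partial>M)
      = (\<integral>\<^sup>+\<omega>. (\<integral>\<^sup>+y. ennreal (fs (zo_step (\<tau> k) (X k \<omega>) y) - c) \<partial>std_gaussian)
          + ennreal (\<tau> k * scaled_grad (X k \<omega>)) \<partial>M)"
    by (subst nn_integral_add) auto
  also have "\<dots> \<le> (\<integral>\<^sup>+\<omega>. ennreal (fs (X k \<omega>) - c) + ennreal (step_error (\<tau> k)) \<partial>M)"
    by (intro nn_integral_mono step)
  also have "\<dots> = (\<integral>\<^sup>+\<omega>. ennreal (fs (X k \<omega>) - c) \<partial>M) + ennreal (step_error (\<tau> k))"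
    by (subst nn_integral_add) (auto simp: emeasure_space_1)
  finally show ?thesis .
qed

lemma integrable_of_nn_integral_shift:
  assumes [measurable]: "g \<in> borel_measurable M" and "\<And>\<omega>. c \<le> g \<omega>" "(\<integral>\<^sup>+\<omega>. ennreal (g \<omega> - c) \<partial>M) < \<infinity>"
  shows "integrable M g"
proof -
  have "integrable M (\<lambda>\<omega>. g \<omega> - c)"
    using assms by (intro integrableI_nonneg) auto
  then have "integrable M (\<lambda>\<omega>. (g \<omega> - c) + c)" by (intro Bochner_Integration.integrable_add) auto
  then show ?thesis by simp
qed

lemma nn_integral_fs_finite: "(\<integral>\<^sup>+\<omega>. ennreal (fs (X k \<omega>) - c) \<partial>M) < \<infinity>"
proof (induction k)
  case 0
  then show ?case by (simp add: emeasure_space_1)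
next
  case (Suc k)
  then have fin: "(\<integral>\<^sup>+\<omega>. ennreal (fs (X k \<omega>) - c) \<partial>M) + ennreal (step_error (\<tau> k)) < \<infinity>"
    by (simp add: less_top)
  show ?case
    by (rule le_less_trans[OF order_trans[OF add_increasing2 nn_integral_step_le] fin]) simp_all
qed

lemma integrable_fs_X: "integrable M (\<lambda>\<omega>. fs (X k \<omega>))"
  by (rule integrable_of_nn_integral_shift) (auto simp: fs_ge[OF lower] nn_integral_fs_finite[simplified])

text \<open>The gradient term sits on the left of \<open>nn_integral_step_le\<close>, so the finite
  right side bounds it too; dividing by \<open>\<tau> k > 0\<close> finishes.\<close>

lemma integrable_scaled_grad_X: "integrable M (\<lambda>\<omega>. scaled_grad (X k \<omega>))"
proof -
  have fin: "(\<integral>\<^sup>+\<omega>. ennreal (fs (X k \<omega>) - c) \<partial>M) + ennreal (step_error (\<tau> k)) < \<infinity>"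
    using nn_integral_fs_finite[of k] by (simp add: less_top)
  have "(\<integral>\<^sup>+\<omega>. ennreal (\<tau> k * scaled_grad (X k \<omega>)) \<partial>M) < \<infinity>"
    by (rule le_less_trans[OF order_trans[OF add_increasing nn_integral_step_le] fin]) simp_all
  then have "integrable M (\<lambda>\<omega>. \<tau> k * scaled_grad (X k \<omega>))"
    using tau_pos[of k] scaled_grad_nonneg by (intro integrableI_nonneg) auto
  then show ?thesis using tau_pos[of k] by simp
qed

lemma expected_fs_ge: "c \<le> expectation (\<lambda>\<omega>. fs (X k \<omega>))"
  using integral_mono[OF _ integrable_fs_X, of "\<lambda>_. c"] fs_ge[OF lower] by (simp add: prob_space)

lemma expected_scaled_grad_nonneg: "0 \<le> expectation (\<lambda>\<omega>. scaled_grad (X k \<omega>))"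
  by (simp add: scaled_grad_nonneg)

lemma expected_descent:
  "expectation (\<lambda>\<omega>. fs (X (Suc k) \<omega>)) + \<tau> k * expectation (\<lambda>\<omega>. scaled_grad (X k \<omega>))
    \<le> expectation (\<lambda>\<omega>. fs (X k \<omega>)) + step_error (\<tau> k)"
proof -
  have shift: "(\<integral>\<^sup>+\<omega>. ennreal (fs (X k \<omega>) - c) \<partial>M) = ennreal (expectation (\<lambda>\<omega>. fs (X k \<omega>)) - c)" for k
  proof -
    have "(\<integral>\<^sup>+\<omega>. ennreal (fs (X k \<omega>) - c) \<partial>M) = ennreal (expectation (\<lambda>\<omega>. fs (X k \<omega>) - c))"
      using integrable_fs_X fs_ge[OF lower] by (intro nn_integral_eq_integral) auto
    also have "expectation (\<lambda>\<omega>. fs (X k \<omega>) - c) = expectation (\<lambda>\<omega>. fs (X k \<omega>)) - c"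
      using integrable_fs_X by (simp add: prob_space)
    finally show ?thesis .
  qed
  have grad: "(\<integral>\<^sup>+\<omega>. ennreal (\<tau> k * scaled_grad (X k \<omega>)) \<partial>M)
      = ennreal (\<tau> k * expectation (\<lambda>\<omega>. scaled_grad (X k \<omega>)))"
    using integrable_scaled_grad_X[of k] scaled_grad_nonneg tau_pos[of k]
    by (subst nn_integral_eq_integral) auto
  define e where "e j = expectation (\<lambda>\<omega>. fs (X j \<omega>))" for j
  define w where "w = expectation (\<lambda>\<omega>. scaled_grad (X k \<omega>))"
  have nonneg: "0 \<le> e j - c" "0 \<le> \<tau> k * w" "0 \<le> step_error (\<tau> k)" for j
    using expected_fs_ge[of j] expected_scaled_grad_nonneg[of k] tau_pos[of k]
    by (simp_all add: e_def w_def step_error_nonneg)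
  have "ennreal (e (Suc k) - c) + ennreal (\<tau> k * w) \<le> ennreal (e k - c) + ennreal (step_error (\<tau> k))"
    using nn_integral_step_le[of k] unfolding shift grad e_def w_def .
  then have "e (Suc k) - c + \<tau> k * w \<le> e k - c + step_error (\<tau> k)"
    using nonneg by (simp add: add_nonneg_nonneg flip: ennreal_plus)
  then show ?thesis unfolding e_def w_def by linarith
qed

lemma expected_fs_Suc_le:
  "expectation (\<lambda>\<omega>. fs (X (Suc k) \<omega>)) \<le> expectation (\<lambda>\<omega>. fs (X k \<omega>)) + step_error (\<tau> k)"
  using expected_descent[of k] expected_scaled_grad_nonneg[of k] tau_pos[of k]
    mult_nonneg_nonneg[of "\<tau> k" "expectation (\<lambda>\<omega>. scaled_grad (X k \<omega>))"] by linarith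

lemma sum_scaled_grad_le:
  "(\<Sum>k<n. \<tau> k * expectation (\<lambda>\<omega>. scaled_grad (X k \<omega>))) \<le> fs x0 - c + (\<Sum>k<n. step_error (\<tau> k))"
proof -
  have "(\<Sum>k<n. \<tau> k * expectation (\<lambda>\<omega>. scaled_grad (X k \<omega>)))
      \<le> fs x0 - expectation (\<lambda>\<omega>. fs (X n \<omega>)) + (\<Sum>k<n. step_error (\<tau> k))"
  proof (induction n)
    case 0
    then show ?case by (simp add: prob_space)
  next
    case (Suc n)
    then show ?case using expected_descent[of n] by simp
  qed
  then show ?thesis using expected_fs_ge[of n] by linarith
qed

lemma min_scaled_grad_le:
  "Min ((\<lambda>k. expectation (\<lambda>\<omega>. scaled_grad (X k \<omega>))) ` {0..T})
    \<le> (fs x0 - c + (\<Sum>k=0..T. step_error (\<tau> k))) / (\<Sum>k=0..T. \<tau> k)"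
proof -
  let ?w = "\<lambda>k. expectation (\<lambda>\<omega>. scaled_grad (X k \<omega>))"
  have pos: "(\<Sum>k=0..T. \<tau> k) > 0" using tau_pos by (intro sum_pos) auto
  \<comment> \<open>A minimum is at most the average with weights \<open>\<tau> k\<close>, which is
    the quantity that telescoping controls.\<close>
  have "Min (?w ` {0..T}) * (\<Sum>k=0..T. \<tau> k) = (\<Sum>k=0..T. \<tau> k * Min (?w ` {0..T}))"
    by (simp add: sum_distrib_right mult.commute[of "Min _"])
  also have "\<dots> \<le> (\<Sum>k=0..T. \<tau> k * ?w k)"
    using tau_pos by (intro sum_mono mult_left_mono) (auto simp: less_imp_le)
  \<comment> \<open>Summing the indices 0 to T takes \<open>Suc T\<close> steps, so the telescope
    ends at iterate T + 1, whose expected value is at least \<open>c\<close>.\<close>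
  also have "\<dots> \<le> fs x0 - c + (\<Sum>k=0..T. step_error (\<tau> k))"
    using sum_scaled_grad_le[of "Suc T"] by (simp add: lessThan_Suc_atMost atLeast0AtMost)
  finally show ?thesis using pos by (simp add: pos_le_divide_eq)
qed

end

theorem theorem4p8:
  fixes f :: "'a::euclidean_space \<Rightarrow> real"
    and R1 R2 \<sigma> :: real and m :: nat
    and x0 :: 'a and \<tau> :: "nat \<Rightarrow> real"
    and M :: "'w measure" and u :: "nat \<Rightarrow> 'w \<Rightarrow> 'a"
  assumes spb: "SPB f R1 R2 m"
    and bdd: "bdd_below (range f)"
    and sigma_pos: "\<sigma> > 0"
    and tau: "\<And>k. 0 < \<tau> k \<and> \<tau> k \<le> 1"
    and prob: "prob_space M"
    and indep: "prob_space.indep_vars M (\<lambda>_. borel) u UNIV"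
    and gauss: "\<And>k. distr M lborel (u k) = std_gaussian"
  shows
    "let d = real DIM('a);
         x = zo_iter f \<sigma> \<tau> m x0 u;
         f\<^sub>\<sigma> = gauss_smooth f \<sigma>;
         E = (\<lambda>X. \<integral>\<omega>. X \<omega> \<partial>M);
         A = 2 powr (2 * real m - 2) * R1 * \<sigma> powr (real m - 1) * (real m + 1 + d) powr ((real m + 1) / 2)
             + R2 * sqrt d / \<sigma>;
         B = 2 powr (2 * real m - 2) * R1 * sqrt d / \<sigma>;
         C = 2 powr (real m - 1) * R1 * sqrt d / \<sigma>;
         H2 = H_const R1 R2 m \<sigma> DIM('a) 2;
         Hm2 = H_const R1 R2 m \<sigma> DIM('a) (m + 2);
         Mx0 = (2 powr (real m - 1) * R1 * norm x0 ^ m + R2) * sqrt d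
               + 2 powr (real m - 1) * R1 * \<sigma> ^ m * (real m + 1 + d) powr ((real m + 1) / 2);
         w2 = (\<lambda>k. E (\<lambda>\<omega>. (norm (grad f\<^sub>\<sigma> (x k \<omega>)))\<^sup>2 / (norm (x k \<omega>) ^ m + 1)\<^sup>2))
     in (\<forall>k. E (\<lambda>\<omega>. f\<^sub>\<sigma> (x (Suc k) \<omega>))
             \<le> E (\<lambda>\<omega>. f\<^sub>\<sigma> (x k \<omega>)) + H2 * (\<tau> k)\<^sup>2 * (A + B) / 2
                + C / (real m + 2) * Hm2 * \<tau> k ^ (m + 2))
      \<and> (\<forall>T::nat. T > 0 \<longrightarrow>
           Min (w2 ` {0..T})
             \<le> (Mx0 * \<sigma> + f x0 - Inf (range f) + 0.5 * H2 * (A + B) * (\<Sum>k=0..T. (\<tau> k)\<^sup>2)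
                 + Hm2 * C / (real m + 2) * (\<Sum>k=0..T. \<tau> k ^ (m + 2)))
               / (\<Sum>k=0..T. \<tau> k))"
proof -
  interpret P: zo_process f R1 R2 \<sigma> m M u x0 \<tau> "Inf (range f)"
  proof (intro zo_process.intro poly_lipschitz.intro prob zo_process_axioms.intro)
    show "Inf (range f) \<le> f y" for y by (intro cInf_lower bdd) simp
  qed (use spb SPB_lipschitz_on_cball[OF spb] sigma_pos tau indep gauss in \<open>auto simp: SPB_def\<close>)
  have step: "P.expectation (\<lambda>\<omega>. P.fs (P.X (Suc k) \<omega>))
      \<le> P.expectation (\<lambda>\<omega>. P.fs (P.X k \<omega>)) + P.H 2 * (\<tau> k)\<^sup>2 * (P.A + P.B) / 2
        + P.C / (real m + 2) * P.H (m + 2) * \<tau> k ^ (m + 2)" for k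
    using P.expected_fs_Suc_le[of k] by (simp only: P.step_error_def add.assoc)
  define Mx0 where "Mx0 = (2 powr (real m - 1) * R1 * norm x0 ^ m + R2) * sqrt (real DIM('a))
      + 2 powr (real m - 1) * R1 * \<sigma> ^ m * (real m + 1 + real DIM('a)) powr ((real m + 1) / 2)"
  have min: "Min ((\<lambda>k. P.expectation (\<lambda>\<omega>. (norm (grad P.fs (P.X k \<omega>)))\<^sup>2 / (norm (P.X k \<omega>) ^ m + 1)\<^sup>2)) ` {0..T})
      \<le> (Mx0 * \<sigma> + f x0 - Inf (range f) + 0.5 * P.H 2 * (P.A + P.B) * (\<Sum>k=0..T. (\<tau> k)\<^sup>2)
                 + P.H (m + 2) * P.C / (real m + 2) * (\<Sum>k=0..T. \<tau> k ^ (m + 2)))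
               / (\<Sum>k=0..T. \<tau> k)" for T
  proof -
    have sum: "(\<Sum>k=0..T. P.step_error (\<tau> k)) = 0.5 * P.H 2 * (P.A + P.B) * (\<Sum>k=0..T. (\<tau> k)\<^sup>2)
        + P.H (m + 2) * P.C / (real m + 2) * (\<Sum>k=0..T. \<tau> k ^ (m + 2))"
      unfolding P.step_error_def sum.distrib sum_distrib_left by (simp add: mult_ac)
    \<comment> \<open>Replaces the smoothed initial value by \<open>f x0\<close>; this is the only
      place where M(x0) enters.\<close>
    have "P.fs x0 \<le> Mx0 * \<sigma> + f x0"
      using P.fs_le[of x0] by (simp add: Mx0_def mult.commute)
    then have "(P.fs x0 - Inf (range f) + (\<Sum>k=0..T. P.step_error (\<tau> k))) / (\<Sum>k=0..T. \<tau> k)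
        \<le> (Mx0 * \<sigma> + f x0 - Inf (range f) + (\<Sum>k=0..T. P.step_error (\<tau> k))) / (\<Sum>k=0..T. \<tau> k)"
      using tau by (intro divide_right_mono sum_nonneg) (auto intro: less_imp_le)
    with P.min_scaled_grad_le[of T] show ?thesis
      unfolding P.scaled_grad_def sum add.assoc by (rule order_trans)
  qed
  show ?thesis
    unfolding Let_def
    using step min
    unfolding P.A_def P.B_def P.C_def P.H_def Mx0_def by blast
qed

end
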